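(* Let $(M,\phi,\xi,\eta,g)$ be a non-Sasakian contact metric $(\kappa,\mu)$-space, $\lambda=\sqrt{1-\kappa}$ and $I_M:=\dfrac{1-\frac\mu2}{\sqrt{1-\kappa}}$. The Legendre foliations $\mathcal D_{\phi h}(\lambda)$ and $\mathcal D_{\phi h}(-\lambda)$ are either non-degenerate or flat. In particular, $\mathcal D_{\phi h}(\lambda)$ and $\mathcal D_{\phi h}(-\lambda)$ are positive definite if and only if $I_M>0$, negative definite if and only if $I_M<0$, and flat if and only if $I_M=0$.
   Context: Everything is smooth. A contact metric manifold $(M,\phi,\xi,\eta,g)$ is a $(2n+1)$-dimensional manifold with a $(1,1)$-tensor $\phi$, vector field $\xi$, $1$-form $\eta$ and Riemannian metric $g$ such that $\phi^2=-I+\eta\otimes\xi$, $\eta(\xi)=1$, $g(\phi X,\phi Y)=g(X,Y)-\eta(X)\eta(Y)$ and $d\eta(X,Y)=g(X,\phi Y)$, where $2d\eta(X,Y)=X(\eta(Y))-Y(\eta(X))-\eta([X,Y])$. Put $\mathcal D=\ker\eta$, $h:=\frac12\mathcal L_\xi\phi$. It is Sasakian if $[\phi,\phi]+2d\eta\otimes\xi=0$, where $[\phi,\phi](X,Y)=\phi^2[X,Y]+[\phi X,\phi Y]-\phi[\phi X,Y]-\phi[X,\phi Y]$. A contact metric $(\kappa,\mu)$-space, $\kappa,\mu\in\mathbb R$, is a contact metric manifold whose Levi-Civita curvature $R^g(X,Y)=[\nabla^g_X,\nabla^g_Y]-\nabla^g_{[X,Y]}$ satisfies $R^g(X,Y)\xi=\kappa(\eta(Y)X-\eta(X)Y)+\mu(\eta(Y)hX-\eta(X)hY)$;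 non-Sasakian implies $\kappa<1$. $\mathcal D_{\phi h}(\pm\lambda)$ denotes the eigendistribution of $\phi h$ for the eigenvalue $\pm\lambda$; on a non-Sasakian contact metric $(\kappa,\mu)$-space these are Legendre foliations, i.e. involutive rank $n$ subbundles of $\mathcal D$. For a Legendre foliation $\mathcal F$, Pang's symmetric bilinear form on its tangent bundle is $\Pi_{\mathcal F}(X,X')=-(\mathcal L_X\mathcal L_{X'}\eta)(\xi)=2d\eta([\xi,X],X')$. $\mathcal F$ is called positive (negative) definite, non-degenerate, degenerate or flat according to whether $\Pi_{\mathcal F}$ is positive (negative) definite, non-degenerate, degenerate or identically zero. *)

theory Defs
  imports "HOL-Analysis.Analysis"
begin

section \<open>Smooth manifolds\<close>

text \<open>For open \<open>S\<close> in a Euclidean space: \<open>f\<close> is of class \<open>C^k\<close> on \<open>S\<close>.\<close>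

primrec Ck_on :: "nat \<Rightarrow> ('e::euclidean_space \<Rightarrow> 'b::real_normed_vector) \<Rightarrow> 'e set \<Rightarrow> bool" where
  "Ck_on 0 f S \<longleftrightarrow> continuous_on S f"
| "Ck_on (Suc k) f S \<longleftrightarrow>
     (\<forall>x\<in>S. f differentiable (at x)) \<and> (\<forall>v. Ck_on k (\<lambda>x. frechet_derivative f (at x) v) S)"

definition smooth_on :: "'e set \<Rightarrow> ('e::euclidean_space \<Rightarrow> 'b::real_normed_vector) \<Rightarrow> bool" where
  "smooth_on S f \<longleftrightarrow> (\<forall>k. Ck_on k f S)"

text \<open>
  The manifold is the whole type \<open>'a\<close>, with the Hausdorff, second countable topology given by its
  type classes; it is modelled on the Euclidean space \<open>'e\<close>. A chart is a pair \<open>(U, \<psi>)\<close> of a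
  coordinate domain and a map of which only the restriction to \<open>U\<close> matters.
  The manifold need not be connected, and the atlas need not be maximal.
\<close>

type_synonym ('a, 'e) chart = "'a set \<times> ('a \<Rightarrow> 'e)"

definition smooth_atlas ::
  "('a::{t2_space,second_countable_topology}, 'e::euclidean_space) chart set \<Rightarrow> bool" where
  "smooth_atlas A \<longleftrightarrow>
     (\<forall>(U, \<psi>)\<in>A. open U \<and> open (\<psi> ` U) \<and> homeomorphism U (\<psi> ` U) \<psi> (inv_into U \<psi>)) \<and>
     (\<Union>(U, \<psi>)\<in>A. U) = UNIV \<and>
     (\<forall>(U, \<psi>)\<in>A. \<forall>(V, \<theta>)\<in>A. smooth_on (\<psi> ` (U \<inter> V)) (\<theta> \<circ> inv_into U \<psi>))"

definition smooth_fun ::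
  "('a::{t2_space,second_countable_topology}, 'e::euclidean_space) chart set \<Rightarrow> ('a \<Rightarrow> real) \<Rightarrow> bool" where
  "smooth_fun A f \<longleftrightarrow> (\<forall>(U, \<psi>)\<in>A. smooth_on (\<psi> ` U) (f \<circ> inv_into U \<psi>))"


section \<open>Vector fields and tensor fields\<close>

text \<open>
  Tangent vectors at \<open>p\<close> are the derivations at \<open>p\<close> of the algebra of smooth functions. Being HOL
  functions they are total; they are normalised to \<open>0\<close> on functions that are not smooth, so that
  equal derivations are equal objects. Linear combinations are taken pointwise.
\<close>

type_synonym 'a tvec = "('a \<Rightarrow> real) \<Rightarrow> real"
type_synonym 'a vfield = "'a \<Rightarrow> 'a tvec"

definition tangent_space ::
  "('a::{t2_space,second_countable_topology}, 'e::euclidean_space) chart set \<Rightarrow> 'a \<Rightarrow> 'a tvec set" where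
  "tangent_space A p = {v.
     (\<forall>f g. smooth_fun A f \<longrightarrow> smooth_fun A g \<longrightarrow>
        v (\<lambda>q. f q + g q) = v f + v g \<and>
        v (\<lambda>q. f q * g q) = f p * v g + g p * v f) \<and>
     (\<forall>c f. smooth_fun A f \<longrightarrow> v (\<lambda>q. c * f q) = c * v f) \<and>
     (\<forall>f. \<not> smooth_fun A f \<longrightarrow> v f = 0)}"

definition vector_field ::
  "('a::{t2_space,second_countable_topology}, 'e::euclidean_space) chart set \<Rightarrow> 'a vfield \<Rightarrow> bool" where
  "vector_field A X \<longleftrightarrow>
     (\<forall>p. X p \<in> tangent_space A p) \<and>
     (\<forall>f. smooth_fun A f \<longrightarrow> smooth_fun A (\<lambda>p. X p f))"

definition lie_bracket :: "'a vfield \<Rightarrow> 'a vfield \<Rightarrow> 'a vfield" where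
  "lie_bracket X Y = (\<lambda>p f. X p (\<lambda>q. Y q f) - Y p (\<lambda>q. X q f))"

text \<open>
  Tensor fields are families of (multi)linear maps on the tangent spaces that send smooth vector
  fields to smooth objects. Here \<open>app T X\<close> is \<open>\<phi>X\<close> for an endomorphism field \<open>T = \<phi>\<close>,
  the function \<open>\<eta>(X)\<close> for a 1-form \<open>T = \<eta>\<close>, and \<open>app (app g X) Y\<close> is \<open>g(X,Y)\<close>.
\<close>

definition app :: "('a \<Rightarrow> 'a tvec \<Rightarrow> 'c) \<Rightarrow> 'a vfield \<Rightarrow> 'a \<Rightarrow> 'c" where
  "app T X = (\<lambda>p. T p (X p))"

definition one_form ::
  "('a::{t2_space,second_countable_topology}, 'e::euclidean_space) chart set \<Rightarrow>
   ('a \<Rightarrow> 'a tvec \<Rightarrow> real) \<Rightarrow> bool" where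
  "one_form A \<omega> \<longleftrightarrow>
     (\<forall>p. \<forall>v\<in>tangent_space A p. \<forall>w\<in>tangent_space A p. \<forall>a b.
        \<omega> p (\<lambda>f. a * v f + b * w f) = a * \<omega> p v + b * \<omega> p w) \<and>
     (\<forall>X. vector_field A X \<longrightarrow> smooth_fun A (app \<omega> X))"

definition endo_field ::
  "('a::{t2_space,second_countable_topology}, 'e::euclidean_space) chart set \<Rightarrow>
   ('a \<Rightarrow> 'a tvec \<Rightarrow> 'a tvec) \<Rightarrow> bool" where
  "endo_field A T \<longleftrightarrow>
     (\<forall>p. \<forall>v\<in>tangent_space A p. T p v \<in> tangent_space A p) \<and>
     (\<forall>p. \<forall>v\<in>tangent_space A p. \<forall>w\<in>tangent_space A p. \<forall>a b.
        T p (\<lambda>f. a * v f + b * w f) = (\<lambda>f. a * T p v f + b * T p w f)) \<and>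
     (\<forall>X. vector_field A X \<longrightarrow> vector_field A (app T X))"

definition riemannian_metric ::
  "('a::{t2_space,second_countable_topology}, 'e::euclidean_space) chart set \<Rightarrow>
   ('a \<Rightarrow> 'a tvec \<Rightarrow> 'a tvec \<Rightarrow> real) \<Rightarrow> bool" where
  "riemannian_metric A g \<longleftrightarrow>
     (\<forall>p. \<forall>u\<in>tangent_space A p. \<forall>v\<in>tangent_space A p. \<forall>w\<in>tangent_space A p. \<forall>a b.
        g p (\<lambda>f. a * u f + b * v f) w = a * g p u w + b * g p v w) \<and>
     (\<forall>p. \<forall>v\<in>tangent_space A p. \<forall>w\<in>tangent_space A p. g p v w = g p w v) \<and>
     (\<forall>p. \<forall>v\<in>tangent_space A p. v \<noteq> (\<lambda>f. 0) \<longrightarrow> g p v v > 0) \<and>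
     (\<forall>X Y. vector_field A X \<longrightarrow> vector_field A Y \<longrightarrow> smooth_fun A (app (app g X) Y))"

text \<open>The normalisation \<open>2d\<omega>(X,Y) = X(\<omega>(Y)) - Y(\<omega>(X)) - \<omega>([X,Y])\<close>.\<close>

definition ext_deriv :: "('a \<Rightarrow> 'a tvec \<Rightarrow> real) \<Rightarrow> 'a vfield \<Rightarrow> 'a vfield \<Rightarrow> 'a \<Rightarrow> real" where
  "ext_deriv \<omega> X Y = (\<lambda>p. (X p (app \<omega> Y) - Y p (app \<omega> X) - app \<omega> (lie_bracket X Y) p) / 2)"

text \<open>Lie derivative of a 1-form, and of an endomorphism field, both regarded as operators on
  vector fields.\<close>

definition lie_deriv_form ::
  "'a vfield \<Rightarrow> ('a vfield \<Rightarrow> 'a \<Rightarrow> real) \<Rightarrow> 'a vfield \<Rightarrow> 'a \<Rightarrow> real" where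
  "lie_deriv_form X \<alpha> = (\<lambda>Y p. X p (\<alpha> Y) - \<alpha> (lie_bracket X Y) p)"

definition lie_deriv_endo ::
  "'a vfield \<Rightarrow> ('a vfield \<Rightarrow> 'a vfield) \<Rightarrow> 'a vfield \<Rightarrow> 'a vfield" where
  "lie_deriv_endo X T = (\<lambda>Y p f. lie_bracket X (T Y) p f - T (lie_bracket X Y) p f)"


section \<open>Levi-Civita connection and curvature\<close>

definition affine_connection ::
  "('a::{t2_space,second_countable_topology}, 'e::euclidean_space) chart set \<Rightarrow>
   ('a vfield \<Rightarrow> 'a vfield \<Rightarrow> 'a vfield) \<Rightarrow> bool" where
  "affine_connection A D \<longleftrightarrow>
     (\<forall>X Y. vector_field A X \<longrightarrow> vector_field A Y \<longrightarrow> vector_field A (D X Y)) \<and>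
     (\<forall>X Y Z. vector_field A X \<longrightarrow> vector_field A Y \<longrightarrow> vector_field A Z \<longrightarrow>
        D (\<lambda>p f. X p f + Y p f) Z = (\<lambda>p f. D X Z p f + D Y Z p f) \<and>
        D Z (\<lambda>p f. X p f + Y p f) = (\<lambda>p f. D Z X p f + D Z Y p f)) \<and>
     (\<forall>u X Y. smooth_fun A u \<longrightarrow> vector_field A X \<longrightarrow> vector_field A Y \<longrightarrow>
        D (\<lambda>p f. u p * X p f) Y = (\<lambda>p f. u p * D X Y p f) \<and>
        D X (\<lambda>p f. u p * Y p f) = (\<lambda>p f. u p * D X Y p f + X p u * Y p f))"

definition levi_civita ::
  "('a::{t2_space,second_countable_topology}, 'e::euclidean_space) chart set \<Rightarrow>
   ('a \<Rightarrow> 'a tvec \<Rightarrow> 'a tvec \<Rightarrow> real) \<Rightarrow> ('a vfield \<Rightarrow> 'a vfield \<Rightarrow> 'a vfield) \<Rightarrow> bool" where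
  "levi_civita A g D \<longleftrightarrow>
     affine_connection A D \<and>
     (\<forall>X Y. vector_field A X \<longrightarrow> vector_field A Y \<longrightarrow>
        lie_bracket X Y = (\<lambda>p f. D X Y p f - D Y X p f)) \<and>
     (\<forall>X Y Z. vector_field A X \<longrightarrow> vector_field A Y \<longrightarrow> vector_field A Z \<longrightarrow>
        (\<forall>p. X p (app (app g Y) Z) = app (app g (D X Y)) Z p + app (app g Y) (D X Z) p))"

definition curvature ::
  "('a vfield \<Rightarrow> 'a vfield \<Rightarrow> 'a vfield) \<Rightarrow> 'a vfield \<Rightarrow> 'a vfield \<Rightarrow> 'a vfield \<Rightarrow> 'a vfield" where
  "curvature D X Y Z =
     (\<lambda>p f. D X (D Y Z) p f - D Y (D X Z) p f - D (lie_bracket X Y) Z p f)"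


section \<open>Contact metric structures\<close>

definition contact_metric_manifold ::
  "('a::{t2_space,second_countable_topology}, 'e::euclidean_space) chart set \<Rightarrow>
   ('a \<Rightarrow> 'a tvec \<Rightarrow> 'a tvec) \<Rightarrow> 'a vfield \<Rightarrow> ('a \<Rightarrow> 'a tvec \<Rightarrow> real) \<Rightarrow>
   ('a \<Rightarrow> 'a tvec \<Rightarrow> 'a tvec \<Rightarrow> real) \<Rightarrow> bool" where
  "contact_metric_manifold A \<phi> \<xi> \<eta> g \<longleftrightarrow>
     smooth_atlas A \<and> (\<exists>n. DIM('e) = 2 * n + 1) \<and>
     endo_field A \<phi> \<and> vector_field A \<xi> \<and> one_form A \<eta> \<and> riemannian_metric A g \<and>
     (\<forall>p. \<forall>v\<in>tangent_space A p. \<phi> p (\<phi> p v) = (\<lambda>f. - v f + \<eta> p v * \<xi> p f)) \<and>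
     (\<forall>p. \<eta> p (\<xi> p) = 1) \<and>
     (\<forall>p. \<forall>v\<in>tangent_space A p. \<forall>w\<in>tangent_space A p.
        g p (\<phi> p v) (\<phi> p w) = g p v w - \<eta> p v * \<eta> p w) \<and>
     (\<forall>X Y. vector_field A X \<longrightarrow> vector_field A Y \<longrightarrow>
        ext_deriv \<eta> X Y = app (app g X) (app \<phi> Y))"

text \<open>The tensor field \<open>h = (1/2) L\<^sub>\<xi> \<phi>\<close>, as an operator on vector fields.\<close>

definition h_op :: "('a \<Rightarrow> 'a tvec \<Rightarrow> 'a tvec) \<Rightarrow> 'a vfield \<Rightarrow> 'a vfield \<Rightarrow> 'a vfield" where
  "h_op \<phi> \<xi> X = (\<lambda>p f. lie_deriv_endo \<xi> (app \<phi>) X p f / 2)"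

definition nijenhuis ::
  "('a \<Rightarrow> 'a tvec \<Rightarrow> 'a tvec) \<Rightarrow> 'a vfield \<Rightarrow> 'a vfield \<Rightarrow> 'a vfield" where
  "nijenhuis \<phi> X Y =
     (\<lambda>p f. app \<phi> (app \<phi> (lie_bracket X Y)) p f + lie_bracket (app \<phi> X) (app \<phi> Y) p f
        - app \<phi> (lie_bracket (app \<phi> X) Y) p f - app \<phi> (lie_bracket X (app \<phi> Y)) p f)"

definition sasakian ::
  "('a::{t2_space,second_countable_topology}, 'e::euclidean_space) chart set \<Rightarrow>
   ('a \<Rightarrow> 'a tvec \<Rightarrow> 'a tvec) \<Rightarrow> 'a vfield \<Rightarrow> ('a \<Rightarrow> 'a tvec \<Rightarrow> real) \<Rightarrow>
   ('a \<Rightarrow> 'a tvec \<Rightarrow> 'a tvec \<Rightarrow> real) \<Rightarrow> bool" where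
  "sasakian A \<phi> \<xi> \<eta> g \<longleftrightarrow>
     contact_metric_manifold A \<phi> \<xi> \<eta> g \<and>
     (\<forall>X Y. vector_field A X \<longrightarrow> vector_field A Y \<longrightarrow>
        (\<forall>p f. nijenhuis \<phi> X Y p f + 2 * ext_deriv \<eta> X Y p * \<xi> p f = 0))"

text \<open>The connection is bound by \<open>\<exists>\<close>; its values on vector fields are determined by \<open>g\<close>.\<close>

definition contact_metric_kappa_mu_space ::
  "('a::{t2_space,second_countable_topology}, 'e::euclidean_space) chart set \<Rightarrow>
   ('a \<Rightarrow> 'a tvec \<Rightarrow> 'a tvec) \<Rightarrow> 'a vfield \<Rightarrow> ('a \<Rightarrow> 'a tvec \<Rightarrow> real) \<Rightarrow>
   ('a \<Rightarrow> 'a tvec \<Rightarrow> 'a tvec \<Rightarrow> real) \<Rightarrow> real \<Rightarrow> real \<Rightarrow> bool" where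
  "contact_metric_kappa_mu_space A \<phi> \<xi> \<eta> g \<kappa> \<mu> \<longleftrightarrow>
     contact_metric_manifold A \<phi> \<xi> \<eta> g \<and>
     (\<exists>D. levi_civita A g D \<and>
        (\<forall>X Y. vector_field A X \<longrightarrow> vector_field A Y \<longrightarrow>
           curvature D X Y \<xi> =
             (\<lambda>p f. \<kappa> * (app \<eta> Y p * X p f - app \<eta> X p * Y p f)
                  + \<mu> * (app \<eta> Y p * h_op \<phi> \<xi> X p f - app \<eta> X p * h_op \<phi> \<xi> Y p f))))"


section \<open>Distributions and Pang's form\<close>

text \<open>
  A distribution is given by its fibres. The fibre over \<open>p\<close> of the eigendistribution of \<open>\<phi>h\<close>
  consists of the \<open>v\<close> with \<open>(\<phi>h)\<^sub>p v = c v\<close>, where \<open>(\<phi>h)\<^sub>p v\<close> is the value at \<open>p\<close> of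
  \<open>\<phi>hX\<close> for a vector field \<open>X\<close> extending \<open>v\<close>; as \<open>\<phi>h\<close> is tensorial, the extension is immaterial.
\<close>

definition eigendistribution_phi_h ::
  "('a::{t2_space,second_countable_topology}, 'e::euclidean_space) chart set \<Rightarrow>
   ('a \<Rightarrow> 'a tvec \<Rightarrow> 'a tvec) \<Rightarrow> 'a vfield \<Rightarrow> real \<Rightarrow> 'a \<Rightarrow> 'a tvec set" where
  "eigendistribution_phi_h A \<phi> \<xi> c p =
     {v. \<exists>X. vector_field A X \<and> X p = v \<and> app \<phi> (h_op \<phi> \<xi> X) p = (\<lambda>f. c * v f)}"

definition sections_of ::
  "('a::{t2_space,second_countable_topology}, 'e::euclidean_space) chart set \<Rightarrow>
   ('a \<Rightarrow> 'a tvec set) \<Rightarrow> 'a vfield set" where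
  "sections_of A F = {X. vector_field A X \<and> (\<forall>p. X p \<in> F p)}"

text \<open>\<open>\<Pi>(X,X') = -(L\<^sub>X L\<^sub>X\<^sub>' \<eta>)(\<xi>)\<close> on sections, and the bilinear form it induces on the fibres.\<close>

definition pang :: "'a vfield \<Rightarrow> ('a \<Rightarrow> 'a tvec \<Rightarrow> real) \<Rightarrow> 'a vfield \<Rightarrow> 'a vfield \<Rightarrow> 'a \<Rightarrow> real" where
  "pang \<xi> \<eta> X X' = (\<lambda>p. - lie_deriv_form X (lie_deriv_form X' (app \<eta>)) \<xi> p)"

definition pang_at ::
  "('a::{t2_space,second_countable_topology}, 'e::euclidean_space) chart set \<Rightarrow>
   'a vfield \<Rightarrow> ('a \<Rightarrow> 'a tvec \<Rightarrow> real) \<Rightarrow> ('a \<Rightarrow> 'a tvec set) \<Rightarrow> 'a \<Rightarrow> 'a tvec \<Rightarrow> 'a tvec \<Rightarrow> real" where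
  "pang_at A \<xi> \<eta> F p v w =
     (THE c. \<exists>X\<in>sections_of A F. \<exists>X'\<in>sections_of A F. X p = v \<and> X' p = w \<and> c = pang \<xi> \<eta> X X' p)"

definition positive_definite_foliation ::
  "('a::{t2_space,second_countable_topology}, 'e::euclidean_space) chart set \<Rightarrow>
   'a vfield \<Rightarrow> ('a \<Rightarrow> 'a tvec \<Rightarrow> real) \<Rightarrow> ('a \<Rightarrow> 'a tvec set) \<Rightarrow> bool" where
  "positive_definite_foliation A \<xi> \<eta> F \<longleftrightarrow>
     (\<forall>p. \<forall>v\<in>F p. v \<noteq> (\<lambda>f. 0) \<longrightarrow> pang_at A \<xi> \<eta> F p v v > 0)"

definition negative_definite_foliation ::
  "('a::{t2_space,second_countable_topology}, 'e::euclidean_space) chart set \<Rightarrow>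
   'a vfield \<Rightarrow> ('a \<Rightarrow> 'a tvec \<Rightarrow> real) \<Rightarrow> ('a \<Rightarrow> 'a tvec set) \<Rightarrow> bool" where
  "negative_definite_foliation A \<xi> \<eta> F \<longleftrightarrow>
     (\<forall>p. \<forall>v\<in>F p. v \<noteq> (\<lambda>f. 0) \<longrightarrow> pang_at A \<xi> \<eta> F p v v < 0)"

definition nondegenerate_foliation ::
  "('a::{t2_space,second_countable_topology}, 'e::euclidean_space) chart set \<Rightarrow>
   'a vfield \<Rightarrow> ('a \<Rightarrow> 'a tvec \<Rightarrow> real) \<Rightarrow> ('a \<Rightarrow> 'a tvec set) \<Rightarrow> bool" where
  "nondegenerate_foliation A \<xi> \<eta> F \<longleftrightarrow>
     (\<forall>p. \<forall>v\<in>F p. (\<forall>w\<in>F p. pang_at A \<xi> \<eta> F p v w = 0) \<longrightarrow> v = (\<lambda>f. 0))"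

definition flat_foliation ::
  "('a::{t2_space,second_countable_topology}, 'e::euclidean_space) chart set \<Rightarrow>
   'a vfield \<Rightarrow> ('a \<Rightarrow> 'a tvec \<Rightarrow> real) \<Rightarrow> ('a \<Rightarrow> 'a tvec set) \<Rightarrow> bool" where
  "flat_foliation A \<xi> \<eta> F \<longleftrightarrow>
     (\<forall>p. \<forall>v\<in>F p. \<forall>w\<in>F p. pang_at A \<xi> \<eta> F p v w = 0)"

definition I_inv :: "real \<Rightarrow> real \<Rightarrow> real" where
  "I_inv \<kappa> \<mu> = (1 - \<mu> / 2) / sqrt (1 - \<kappa>)"

end

theory Submission
  imports Defs "HOL-Library.Function_Algebras"
begin

text \<open>
  Let \<open>D\<close> be the Levi-Civita connection and put \<open>S X = D\<^sub>X \<xi> + \<phi> X\<close>. The contact condition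
  \<open>d\<eta>(X,Y) = g(X,\<phi>Y)\<close> says that \<open>- \<phi>\<close> is the skew part of \<open>X \<mapsto> D\<^sub>X \<xi>\<close>, so \<open>S\<close> is its symmetric
  part. Closedness of \<open>d\<eta>\<close> gives \<open>D\<^sub>\<xi> \<phi> = - (S\<phi> + \<phi>S)\<close> (lemma \<open>DPhi_xi_eq\<close>); as \<open>D\<^sub>\<xi> \<phi>\<close> anticommutes
  with \<open>\<phi>\<close>, both sides vanish (lemma \<open>S_Phi\<close>). It follows that \<open>h = \<phi>S\<close> and \<open>\<phi>h = - S\<close>, so that the
  eigendistributions of \<open>\<phi>h\<close> are those of the symmetric operator \<open>S\<close>.

  The curvature condition for \<open>R(X,\<xi>)\<xi>\<close> is one equation between an operator that commutes with \<open>\<phi>\<close>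
  and one that anticommutes with it. Both parts hold separately (lemma \<open>S_squared_and_Dxi_S\<close>):
  \<open>S\<^sup>2 = (1 - \<kappa>) id\<close> on \<open>ker \<eta>\<close>, and \<open>D\<^sub>\<xi> S = - \<mu> \<phi>S\<close>.

  For eigenfields \<open>X\<close>, \<open>Y\<close> of \<open>S\<close> with the same eigenvalue \<open>s \<noteq> 0\<close>, Pang's form is
  \<open>2 g(Y, \<phi>[X,\<xi>])\<close>, where \<open>[X,\<xi>] = S X - \<phi> X - D\<^sub>\<xi> X\<close>. The first term contributes nothing because
  \<open>\<phi>\<close> exchanges the eigendistributions for \<open>s\<close> and \<open>- s\<close>, the second contributes \<open>2 g(X,Y)\<close>, and the
  formula for \<open>D\<^sub>\<xi> S\<close> evaluates the third to \<open>- \<mu> g(X,Y)\<close>. Hence \<open>\<Pi> = (2 - \<mu>) g\<close> on both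
  foliations (lemma \<open>pang_eigenfields\<close>). Since \<open>g\<close> is positive definite and \<open>2 - \<mu>\<close> has the sign of
  \<open>I\<^sub>M\<close>, the trichotomy follows as soon as \<open>\<kappa> < 1\<close> and the eigendistributions are non-zero somewhere.

  These two facts come from the failure of the Sasakian condition (lemma \<open>non_Sasakian\<close>). A field
  \<open>Z = \<phi> Y \<noteq> 0\<close> exists, since \<open>\<phi> = 0\<close> would make the Nijenhuis tensor and \<open>d\<eta>\<close> vanish. The identity
  \<open>g(S Z, S Z) = (1 - \<kappa>) g(Z, Z)\<close> gives \<open>\<kappa> \<le> 1\<close>, and \<open>\<kappa> = 1\<close> would force \<open>S = 0\<close>; then the curvature
  condition together with the closedness of \<open>d\<eta>\<close> determines \<open>D \<phi>\<close>, and the structure is Sasakian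
  (lemma \<open>Sasakian_of_vanishing_S\<close>).

  Two devices keep everything global. Identities between tensors are proved for vector fields and
  tested against vector fields only, never on a frame. A vector in an eigendistribution comes with a
  field extending it, and the polynomial in \<open>S\<close> that projects onto the eigendistribution turns that
  field into a section (lemma \<open>section_through\<close>), so no bump functions occur.
\<close>

section \<open>Functions as a real vector space\<close>

text \<open>
  Tangent vectors and vector fields are functions with pointwise linear structure; as elements of a
  real vector space they are accessible to the simplifier's arithmetic.
\<close>

instantiation "fun" :: (type, real_vector) real_vector
begin

definition scaleR_fun :: "real \<Rightarrow> ('a \<Rightarrow> 'b) \<Rightarrow> 'a \<Rightarrow> 'b" where
  "c *\<^sub>R f = (\<lambda>x. c *\<^sub>R f x)"

instance
  by standard (auto simp: scaleR_fun_def fun_eq_iff scaleR_add_right scaleR_add_left)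

end

lemma scaleR_fun_apply [simp]: "(c *\<^sub>R f) x = c *\<^sub>R f x"
  by (simp add: scaleR_fun_def)

section \<open>Closure properties of smooth functions\<close>

lemma frechet_derivative_cong_open:
  assumes "open S" "x \<in> S" "\<And>y. y \<in> S \<Longrightarrow> f y = g y"
  shows "frechet_derivative f (at x) = frechet_derivative g (at x)"
proof -
  have "(f has_derivative D) (at x) \<longleftrightarrow> (g has_derivative D) (at x)" for D
    using has_derivative_transform_within_open[OF _ assms(1,2), of f D UNIV g]
      has_derivative_transform_within_open[OF _ assms(1,2), of g D UNIV f] assms(3) by auto
  then show ?thesis
    by (simp add: frechet_derivative_def)
qed

text \<open>
  The derivative of a sum or product is given by the usual formula on \<open>S\<close> only, and the recursion
  in the definition of \<open>C\<^sup>k\<close> needs this weaker form of equality.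
\<close>

lemma Ck_on_cong:
  assumes "open S" "\<And>y. y \<in> S \<Longrightarrow> f y = g y" "Ck_on k f S"
  shows "Ck_on k g S"
  using assms(2,3)
proof (induction k arbitrary: f g)
  case 0
  then show ?case
    using continuous_on_cong[of S S f g] by simp
next
  case (Suc k)
  have "g differentiable (at x)" if "x \<in> S" for x
  proof -
    from Suc.prems(2) that obtain D where "(f has_derivative D) (at x)"
      by (auto simp: differentiable_def)
    then have "(g has_derivative D) (at x)"
      using has_derivative_transform_within_open[OF _ assms(1) that, of f D UNIV g] Suc.prems(1)
      by auto
    then show ?thesis
      by (auto simp: differentiable_def)
  qed
  moreover have "Ck_on k (\<lambda>x. frechet_derivative g (at x) v) S" for v
    by (rule Suc.IH[where f = "\<lambda>x. frechet_derivative f (at x) v"])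
      (use Suc.prems frechet_derivative_cong_open[OF assms(1) _ Suc.prems(1)] in auto)
  ultimately show ?case
    by simp
qed

lemma Ck_on_Suc_imp: "Ck_on (Suc k) f S \<Longrightarrow> Ck_on k f S"
proof (induction k arbitrary: f)
  case 0
  then show ?case
    by (auto intro!: continuous_at_imp_continuous_on differentiable_imp_continuous_within)
qed auto

lemma Ck_on_const: "Ck_on k (\<lambda>x. c) S"
  by (induction k arbitrary: c) auto

lemma Ck_on_add:
  assumes "open S" "Ck_on k f S" "Ck_on k g S"
  shows "Ck_on k (\<lambda>x. f x + g x) S"
  using assms(2,3)
proof (induction k arbitrary: f g)
  case 0
  then show ?case
    by (auto intro: continuous_intros)
next
  case (Suc k)
  have "Ck_on k (\<lambda>x. frechet_derivative (\<lambda>x. f x + g x) (at x) v) S" for v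
  proof (rule Ck_on_cong[OF assms(1)])
    show "Ck_on k (\<lambda>x. frechet_derivative f (at x) v + frechet_derivative g (at x) v) S"
      using Suc.prems by (auto intro: Suc.IH)
    fix y assume "y \<in> S"
    then have "(f has_derivative frechet_derivative f (at y)) (at y)"
      "(g has_derivative frechet_derivative g (at y)) (at y)"
      using Suc.prems by (auto simp: frechet_derivative_works)
    from has_derivative_add[OF this]
    have "frechet_derivative (\<lambda>x. f x + g x) (at y)
        = (\<lambda>v. frechet_derivative f (at y) v + frechet_derivative g (at y) v)"
      by (rule frechet_derivative_at[symmetric])
    then show "frechet_derivative f (at y) v + frechet_derivative g (at y) v
        = frechet_derivative (\<lambda>x. f x + g x) (at y) v"
      by simp
  qed
  then show ?case
    using Suc.prems by auto
qed

lemma Ck_on_mult: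
  fixes f g :: "'e::euclidean_space \<Rightarrow> real"
  assumes "open S" "Ck_on k f S" "Ck_on k g S"
  shows "Ck_on k (\<lambda>x. f x * g x) S"
  using assms(2,3)
proof (induction k arbitrary: f g)
  case 0
  then show ?case
    by (auto intro: continuous_intros)
next
  case (Suc k)
  have "Ck_on k (\<lambda>x. frechet_derivative (\<lambda>x. f x * g x) (at x) v) S" for v
  proof (rule Ck_on_cong[OF assms(1)])
    show "Ck_on k (\<lambda>x. f x * frechet_derivative g (at x) v + frechet_derivative f (at x) v * g x) S"
      using Suc.prems Suc.prems[THEN Ck_on_Suc_imp] by (auto intro!: Ck_on_add[OF assms(1)] Suc.IH)
    fix y assume "y \<in> S"
    then have "(f has_derivative frechet_derivative f (at y)) (at y)"
      "(g has_derivative frechet_derivative g (at y)) (at y)"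
      using Suc.prems by (auto simp: frechet_derivative_works)
    from has_derivative_mult[OF this]
    have "frechet_derivative (\<lambda>x. f x * g x) (at y)
        = (\<lambda>v. f y * frechet_derivative g (at y) v + frechet_derivative f (at y) v * g y)"
      by (rule frechet_derivative_at[symmetric])
    then show "f y * frechet_derivative g (at y) v + frechet_derivative f (at y) v * g y
        = frechet_derivative (\<lambda>x. f x * g x) (at y) v"
      by simp
  qed
  then show ?case
    using Suc.prems by auto
qed

lemma smooth_fun_const: "smooth_fun A (\<lambda>p. c)"
  by (auto simp: smooth_fun_def smooth_on_def o_def Ck_on_const)

lemma smooth_fun_add:
  assumes "smooth_atlas A" "smooth_fun A u" "smooth_fun A v"
  shows "smooth_fun A (u + v)"
  unfolding smooth_fun_def smooth_on_def
proof (clarify)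
  fix U \<psi> k assume U: "(U, \<psi>) \<in> A"
  then have "open (\<psi> ` U)"
    using assms(1) unfolding smooth_atlas_def by fast
  moreover have "Ck_on k (u \<circ> inv_into U \<psi>) (\<psi> ` U)" "Ck_on k (v \<circ> inv_into U \<psi>) (\<psi> ` U)"
    using U assms(2,3) unfolding smooth_fun_def smooth_on_def by fast+
  ultimately show "Ck_on k ((u + v) \<circ> inv_into U \<psi>) (\<psi> ` U)"
    using Ck_on_add by (simp add: o_def)
qed

lemma smooth_fun_mult:
  assumes "smooth_atlas A" "smooth_fun A u" "smooth_fun A v"
  shows "smooth_fun A (u * v)"
  unfolding smooth_fun_def smooth_on_def
proof (clarify)
  fix U \<psi> k assume U: "(U, \<psi>) \<in> A"
  then have "open (\<psi> ` U)"
    using assms(1) unfolding smooth_atlas_def by fast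
  moreover have "Ck_on k (u \<circ> inv_into U \<psi>) (\<psi> ` U)" "Ck_on k (v \<circ> inv_into U \<psi>) (\<psi> ` U)"
    using U assms(2,3) unfolding smooth_fun_def smooth_on_def by fast+
  ultimately show "Ck_on k ((u * v) \<circ> inv_into U \<psi>) (\<psi> ` U)"
    using Ck_on_mult by (simp add: o_def)
qed


section \<open>The module of vector fields\<close>

definition deriv_along :: "'a vfield \<Rightarrow> ('a \<Rightarrow> real) \<Rightarrow> 'a \<Rightarrow> real" where
  "deriv_along X u = (\<lambda>p. X p u)"

definition fscale :: "('a \<Rightarrow> real) \<Rightarrow> 'a vfield \<Rightarrow> 'a vfield"  (infixr "\<odot>" 75) where
  "u \<odot> X = (\<lambda>p. u p *\<^sub>R X p)"

lemma fscale_algebra: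
  "u \<odot> (X + Y) = u \<odot> X + u \<odot> Y" "u \<odot> 0 = 0"
  "(- u) \<odot> X = - (u \<odot> X)" "0 \<odot> X = 0" "1 \<odot> X = X" "c *\<^sub>R (u \<odot> X) = (c *\<^sub>R u) \<odot> X"
  by (auto simp: fscale_def fun_eq_iff algebra_simps)

locale smooth_manifold =
  fixes A :: "('a::{t2_space,second_countable_topology}, 'e::euclidean_space) chart set"
  assumes atlas: "smooth_atlas A"
begin

abbreviation VF :: "'a vfield \<Rightarrow> bool" where "VF \<equiv> vector_field A"
abbreviation SF :: "('a \<Rightarrow> real) \<Rightarrow> bool" where "SF \<equiv> smooth_fun A"

lemma SF_const [simp]: "SF (\<lambda>p. c)" "SF 0" "SF 1"
  using smooth_fun_const[of A] by (simp_all add: zero_fun_def one_fun_def)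

lemma SF_add [simp]: "SF u \<Longrightarrow> SF v \<Longrightarrow> SF (u + v)"
  using smooth_fun_add[OF atlas] by blast

lemma SF_mult [simp]: "SF u \<Longrightarrow> SF v \<Longrightarrow> SF (u * v)"
  using smooth_fun_mult[OF atlas] by blast

lemma SF_scaleR [simp]: "SF u \<Longrightarrow> SF (c *\<^sub>R u)"
  using SF_mult[of "\<lambda>p. c" u] by (simp add: times_fun_def scaleR_fun_def)

lemma SF_minus [simp]: "SF u \<Longrightarrow> SF (- u)"
  using SF_scaleR[of u "-1"] by simp

lemma SF_diff [simp]: "SF u \<Longrightarrow> SF v \<Longrightarrow> SF (u - v)"
  using SF_add[of u "- v"] by simp

lemma tangent_space_iff:
  "v \<in> tangent_space A p \<longleftrightarrow>
     (\<forall>f g. SF f \<longrightarrow> SF g \<longrightarrow> v (f + g) = v f + v g \<and> v (f * g) = f p * v g + g p * v f) \<and>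
     (\<forall>c f. SF f \<longrightarrow> v (c *\<^sub>R f) = c * v f) \<and> (\<forall>f. \<not> SF f \<longrightarrow> v f = 0)"
  unfolding tangent_space_def by (simp add: plus_fun_def times_fun_def scaleR_fun_def)

lemma subspace_tangent_space: "subspace (tangent_space A p)"
  by (rule subspaceI) (auto simp: tangent_space_iff algebra_simps)

lemmas tangent_space_closed [simp] =
  subspace_add[OF subspace_tangent_space] subspace_scale[OF subspace_tangent_space]
  subspace_0[OF subspace_tangent_space] subspace_diff[OF subspace_tangent_space]
  subspace_neg[OF subspace_tangent_space]

lemma VF_in_tangent_space [simp]: "VF X \<Longrightarrow> X p \<in> tangent_space A p"
  by (simp add: vector_field_def)

lemma SF_deriv_along [simp]: "VF X \<Longrightarrow> SF u \<Longrightarrow> SF (deriv_along X u)"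
  by (simp add: vector_field_def deriv_along_def)

lemma VF_iff:
  "VF X \<longleftrightarrow> (\<forall>p. X p \<in> tangent_space A p) \<and> (\<forall>u. SF u \<longrightarrow> SF (deriv_along X u))"
  by (simp add: vector_field_def deriv_along_def)

lemma deriv_along_field_simps [simp]:
  "deriv_along (X + Y) u = deriv_along X u + deriv_along Y u"
  "deriv_along (X - Y) u = deriv_along X u - deriv_along Y u"
  "deriv_along (- X) u = - deriv_along X u"
  "deriv_along (c *\<^sub>R X) u = c *\<^sub>R deriv_along X u"
  "deriv_along (w \<odot> X) u = w * deriv_along X u"
  "deriv_along 0 u = 0"
  by (auto simp: deriv_along_def fun_eq_iff fscale_def)

lemma VF_add [simp]: "VF X \<Longrightarrow> VF Y \<Longrightarrow> VF (X + Y)"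
  unfolding VF_iff by simp

lemma VF_fscale [simp]: "SF u \<Longrightarrow> VF X \<Longrightarrow> VF (u \<odot> X)"
  unfolding VF_iff by (simp, simp add: fscale_def)

lemma VF_scaleR [simp]: "VF X \<Longrightarrow> VF (c *\<^sub>R X)"
  unfolding VF_iff by simp

lemma VF_zero [simp]: "VF 0"
  unfolding VF_iff by simp

lemma VF_minus [simp]: "VF X \<Longrightarrow> VF (- X)"
  unfolding VF_iff by simp

lemma VF_diff [simp]: "VF X \<Longrightarrow> VF Y \<Longrightarrow> VF (X - Y)"
  unfolding VF_iff by simp

lemma deriv_along_add [simp]:
  "VF X \<Longrightarrow> SF u \<Longrightarrow> SF v \<Longrightarrow> deriv_along X (u + v) = deriv_along X u + deriv_along X v"
  unfolding VF_iff tangent_space_iff by (simp add: deriv_along_def fun_eq_iff)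

lemma deriv_along_mult [simp]:
  "VF X \<Longrightarrow> SF u \<Longrightarrow> SF v \<Longrightarrow>
    deriv_along X (u * v) = u * deriv_along X v + v * deriv_along X u"
  unfolding VF_iff tangent_space_iff by (simp add: deriv_along_def fun_eq_iff)

lemma deriv_along_scaleR [simp]:
  "VF X \<Longrightarrow> SF u \<Longrightarrow> deriv_along X (c *\<^sub>R u) = c *\<^sub>R deriv_along X u"
  unfolding VF_iff tangent_space_iff by (simp add: deriv_along_def fun_eq_iff)

lemma deriv_along_minus [simp]: "VF X \<Longrightarrow> SF u \<Longrightarrow> deriv_along X (- u) = - deriv_along X u"
  using deriv_along_scaleR[of X u "-1"] by simp

lemma deriv_along_diff [simp]:
  "VF X \<Longrightarrow> SF u \<Longrightarrow> SF v \<Longrightarrow> deriv_along X (u - v) = deriv_along X u - deriv_along X v"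
  using deriv_along_add[of X u "- v"] by simp

lemma deriv_along_one [simp]: "VF X \<Longrightarrow> deriv_along X 1 = 0"
  using deriv_along_mult[of X 1 1] by simp

lemma deriv_along_zero [simp]: "VF X \<Longrightarrow> deriv_along X 0 = 0"
  using deriv_along_scaleR[of X 0 0] by simp

lemma deriv_along_const [simp]: "VF X \<Longrightarrow> deriv_along X (\<lambda>p. c) = 0"
proof -
  have "(\<lambda>p. c) = c *\<^sub>R (1 :: 'a \<Rightarrow> real)"
    by (simp add: fun_eq_iff)
  then show "VF X \<Longrightarrow> deriv_along X (\<lambda>p. c) = 0"
    by simp
qed

lemma deriv_along_lie_bracket [simp]:
  "deriv_along (lie_bracket X Y) u
    = deriv_along X (deriv_along Y u) - deriv_along Y (deriv_along X u)"
  by (simp add: lie_bracket_def deriv_along_def fun_eq_iff)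

end

section \<open>Contact metric structures with their Levi-Civita connection\<close>

locale contact_metric_levi_civita =
  fixes A :: "('a::{t2_space,second_countable_topology}, 'e::euclidean_space) chart set"
    and \<phi> :: "'a \<Rightarrow> 'a tvec \<Rightarrow> 'a tvec"
    and \<xi> :: "'a vfield"
    and \<eta> :: "'a \<Rightarrow> 'a tvec \<Rightarrow> real"
    and g :: "'a \<Rightarrow> 'a tvec \<Rightarrow> 'a tvec \<Rightarrow> real"
    and D :: "'a vfield \<Rightarrow> 'a vfield \<Rightarrow> 'a vfield"
  assumes contact: "contact_metric_manifold A \<phi> \<xi> \<eta> g"
    and levi_civita: "levi_civita A g D"
begin

sublocale smooth_manifold A
  using contact by unfold_locales (simp add: contact_metric_manifold_def)

abbreviation \<Phi> :: "'a vfield \<Rightarrow> 'a vfield" where "\<Phi> \<equiv> app \<phi>"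
abbreviation \<theta> :: "'a vfield \<Rightarrow> 'a \<Rightarrow> real" where "\<theta> \<equiv> app \<eta>"
abbreviation metric :: "'a vfield \<Rightarrow> 'a vfield \<Rightarrow> 'a \<Rightarrow> real"  ("\<langle>_, _\<rangle>")
  where "\<langle>X, Y\<rangle> \<equiv> app (app g X) Y"

subsection \<open>The structure tensors as operators on vector fields\<close>

lemma endo: "endo_field A \<phi>" and form: "one_form A \<eta>" and riem: "riemannian_metric A g"
  and VF_xi [simp]: "VF \<xi>" and connection: "affine_connection A D"
  using contact levi_civita by (simp_all add: contact_metric_manifold_def levi_civita_def)

lemma VF_Phi [simp]: "VF X \<Longrightarrow> VF (\<Phi> X)"
  using endo by (simp add: endo_field_def)

lemma phi_linear:
  assumes "v \<in> tangent_space A p" "w \<in> tangent_space A p"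
  shows "\<phi> p (v + w) = \<phi> p v + \<phi> p w" "\<phi> p (v - w) = \<phi> p v - \<phi> p w"
    "\<phi> p (c *\<^sub>R v) = c *\<^sub>R \<phi> p v" "\<phi> p (- v) = - \<phi> p v"
proof -
  have *: "\<phi> p (a *\<^sub>R v + b *\<^sub>R w) = a *\<^sub>R \<phi> p v + b *\<^sub>R \<phi> p w" for a b
    using endo assms by (simp add: endo_field_def plus_fun_def scaleR_fun_def)
  show "\<phi> p (v + w) = \<phi> p v + \<phi> p w" "\<phi> p (v - w) = \<phi> p v - \<phi> p w"
    "\<phi> p (c *\<^sub>R v) = c *\<^sub>R \<phi> p v" "\<phi> p (- v) = - \<phi> p v"
    using *[of 1 1] *[of 1 "-1"] *[of c 0] *[of "-1" 0] by simp_all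
qed

lemma eta_linear:
  assumes "v \<in> tangent_space A p" "w \<in> tangent_space A p"
  shows "\<eta> p (v + w) = \<eta> p v + \<eta> p w" "\<eta> p (v - w) = \<eta> p v - \<eta> p w"
    "\<eta> p (c *\<^sub>R v) = c * \<eta> p v" "\<eta> p (- v) = - \<eta> p v"
proof -
  have *: "\<eta> p (a *\<^sub>R v + b *\<^sub>R w) = a * \<eta> p v + b * \<eta> p w" for a b
    using form assms by (simp add: one_form_def plus_fun_def scaleR_fun_def)
  show "\<eta> p (v + w) = \<eta> p v + \<eta> p w" "\<eta> p (v - w) = \<eta> p v - \<eta> p w"
    "\<eta> p (c *\<^sub>R v) = c * \<eta> p v" "\<eta> p (- v) = - \<eta> p v"
    using *[of 1 1] *[of 1 "-1"] *[of c 0] *[of "-1" 0] by simp_all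
qed

lemma g_linear:
  assumes "v \<in> tangent_space A p" "w \<in> tangent_space A p" "u \<in> tangent_space A p"
  shows "g p (v + w) u = g p v u + g p w u" "g p (v - w) u = g p v u - g p w u"
    "g p (c *\<^sub>R v) u = c * g p v u" "g p (- v) u = - g p v u"
proof -
  have *: "g p (a *\<^sub>R v + b *\<^sub>R w) u = a * g p v u + b * g p w u" for a b
    using riem assms by (simp add: riemannian_metric_def plus_fun_def scaleR_fun_def)
  show "g p (v + w) u = g p v u + g p w u" "g p (v - w) u = g p v u - g p w u"
    "g p (c *\<^sub>R v) u = c * g p v u" "g p (- v) u = - g p v u"
    using *[of 1 1] *[of 1 "-1"] *[of c 0] *[of "-1" 0] by simp_all
qed

lemmas phi_scale = phi_linear(3,4)[OF _ subspace_0[OF subspace_tangent_space]]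
lemmas eta_scale = eta_linear(3,4)[OF _ subspace_0[OF subspace_tangent_space]]
lemmas g_scale = g_linear(3,4)[OF _ subspace_0[OF subspace_tangent_space]]

lemma g_sym: "v \<in> tangent_space A p \<Longrightarrow> w \<in> tangent_space A p \<Longrightarrow> g p v w = g p w v"
  using riem unfolding riemannian_metric_def by blast

lemma g_pos: "v \<in> tangent_space A p \<Longrightarrow> v \<noteq> 0 \<Longrightarrow> g p v v > 0"
  using riem unfolding riemannian_metric_def zero_fun_def by blast

lemma Phi_simps [simp]:
  assumes "VF X" "VF Y"
  shows "\<Phi> (X + Y) = \<Phi> X + \<Phi> Y" "\<Phi> (X - Y) = \<Phi> X - \<Phi> Y"
  using assms by (simp_all add: app_def fun_eq_iff fscale_def phi_linear(1,2) phi_scale)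

lemma Phi_scale [simp]:
  assumes "VF X"
  shows "\<Phi> (c *\<^sub>R X) = c *\<^sub>R \<Phi> X" "\<Phi> (u \<odot> X) = u \<odot> \<Phi> X" "\<Phi> (- X) = - \<Phi> X"
  using assms by (simp_all add: app_def fun_eq_iff fscale_def phi_linear(1,2) phi_scale)

lemma theta_simps [simp]:
  assumes "VF X" "VF Y"
  shows "\<theta> (X + Y) = \<theta> X + \<theta> Y" "\<theta> (X - Y) = \<theta> X - \<theta> Y"
  using assms by (simp_all add: app_def fun_eq_iff fscale_def eta_linear(1,2) eta_scale)

lemma theta_scale [simp]:
  assumes "VF X"
  shows "\<theta> (c *\<^sub>R X) = c *\<^sub>R \<theta> X" "\<theta> (u \<odot> X) = u * \<theta> X" "\<theta> (- X) = - \<theta> X"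
  using assms by (simp_all add: app_def fun_eq_iff fscale_def eta_linear(1,2) eta_scale)

lemma metric_sym: "VF X \<Longrightarrow> VF Y \<Longrightarrow> \<langle>X, Y\<rangle> = \<langle>Y, X\<rangle>"
  using g_sym by (simp add: app_def fun_eq_iff)

lemma metric_left [simp]:
  assumes "VF X" "VF Y" "VF Z"
  shows "\<langle>X + Y, Z\<rangle> = \<langle>X, Z\<rangle> + \<langle>Y, Z\<rangle>" "\<langle>X - Y, Z\<rangle> = \<langle>X, Z\<rangle> - \<langle>Y, Z\<rangle>"
  using assms by (simp_all add: app_def fun_eq_iff fscale_def g_linear(1,2) g_scale)

lemma metric_left_scale [simp]:
  assumes "VF X" "VF Z"
  shows "\<langle>c *\<^sub>R X, Z\<rangle> = c *\<^sub>R \<langle>X, Z\<rangle>" "\<langle>u \<odot> X, Z\<rangle> = u * \<langle>X, Z\<rangle>" "\<langle>- X, Z\<rangle> = - \<langle>X, Z\<rangle>"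
  using assms by (simp_all add: app_def fun_eq_iff fscale_def g_linear(1,2) g_scale)

lemma metric_right [simp]:
  assumes "VF X" "VF Y" "VF Z"
  shows "\<langle>Z, X + Y\<rangle> = \<langle>Z, X\<rangle> + \<langle>Z, Y\<rangle>" "\<langle>Z, X - Y\<rangle> = \<langle>Z, X\<rangle> - \<langle>Z, Y\<rangle>"
  using assms by (simp_all add: metric_sym[of Z])

lemma metric_right_scale [simp]:
  assumes "VF X" "VF Z"
  shows "\<langle>Z, c *\<^sub>R X\<rangle> = c *\<^sub>R \<langle>Z, X\<rangle>" "\<langle>Z, u \<odot> X\<rangle> = u * \<langle>Z, X\<rangle>" "\<langle>Z, - X\<rangle> = - \<langle>Z, X\<rangle>"
  using assms by (simp_all add: app_def fun_eq_iff fscale_def g_scale g_sym[of "Z _"])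

lemma operators_zero [simp]:
  "\<Phi> 0 = 0" "\<theta> 0 = 0" "VF X \<Longrightarrow> \<langle>0, X\<rangle> = 0" "VF X \<Longrightarrow> \<langle>X, 0\<rangle> = 0"
  using Phi_scale(1)[of 0 0] theta_scale(1)[of 0 0] metric_left_scale(1)[of 0 X 0]
    metric_right_scale(1)[of 0 X 0] by simp_all

lemma SF_theta [simp]: "VF X \<Longrightarrow> SF (\<theta> X)"
  using form by (simp add: one_form_def)

lemma SF_metric [simp]: "VF X \<Longrightarrow> VF Y \<Longrightarrow> SF \<langle>X, Y\<rangle>"
  using riem by (simp add: riemannian_metric_def)

lemma metric_self_eq_zero:
  assumes "VF X" "\<langle>X, X\<rangle> = 0"
  shows "X = 0"
proof
  fix p
  have "g p (X p) (X p) = 0"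
    using fun_cong[OF assms(2), of p] by (simp add: app_def)
  then show "X p = 0 p"
    using g_pos[of "X p" p] assms(1) by fastforce
qed

text \<open>
  Non-degeneracy of \<open>g\<close>. Testing against smooth fields suffices because the difference of the two
  fields is itself an admissible test field.
\<close>

lemma field_eqI:
  assumes "VF X" "VF Y" "\<And>W. VF W \<Longrightarrow> \<langle>X, W\<rangle> = \<langle>Y, W\<rangle>"
  shows "X = Y"
proof -
  have "X - Y = 0"
    using assms by (intro metric_self_eq_zero) auto
  then show ?thesis
    by simp
qed

lemma Phi_Phi [simp]: "VF X \<Longrightarrow> \<Phi> (\<Phi> X) = - X + \<theta> X \<odot> \<xi>"
  using contact unfolding contact_metric_manifold_def
  by (simp add: app_def fun_eq_iff fscale_def)

lemma theta_xi [simp]: "\<theta> \<xi> = 1"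
  using contact unfolding contact_metric_manifold_def
  by (simp add: app_def fun_eq_iff)

lemma metric_Phi_Phi: "VF X \<Longrightarrow> VF Y \<Longrightarrow> \<langle>\<Phi> X, \<Phi> Y\<rangle> = \<langle>X, Y\<rangle> - \<theta> X * \<theta> Y"
  using contact unfolding contact_metric_manifold_def
  by (simp add: app_def fun_eq_iff)

lemma ext_deriv_eta: "VF X \<Longrightarrow> VF Y \<Longrightarrow> ext_deriv \<eta> X Y = \<langle>X, \<Phi> Y\<rangle>"
  using contact unfolding contact_metric_manifold_def by blast

lemma ext_deriv_eta_expand:
  assumes "VF X" "VF Y"
  shows "2 *\<^sub>R \<langle>X, \<Phi> Y\<rangle>
    = deriv_along X (\<theta> Y) - deriv_along Y (\<theta> X) - \<theta> (lie_bracket X Y)"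
  using fun_cong[OF ext_deriv_eta[OF assms]]
  by (auto simp: ext_deriv_def deriv_along_def fun_eq_iff field_simps)

text \<open>
  From \<open>\<phi>\<^sup>2 \<xi> = 0\<close> and the formula for \<open>\<phi>\<^sup>2\<close> at \<open>\<phi>\<xi>\<close>, the vector \<open>\<phi>\<xi>\<close> is the multiple \<open>\<eta>(\<phi>\<xi>) \<xi>\<close>
  of \<open>\<xi>\<close>. Another \<open>\<phi>\<close> gives \<open>\<eta>(\<phi>\<xi>) \<phi>\<xi> = 0\<close>, and either factor being \<open>0\<close> proves the claim.
\<close>

lemma Phi_xi [simp]: "\<Phi> \<xi> = 0"
proof
  fix p
  have "\<Phi> (\<Phi> (\<Phi> \<xi>)) = 0"
    using Phi_scale(2)[of \<xi> 0] Phi_Phi[of \<xi>] by (simp add: fscale_algebra)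
  then have *: "\<Phi> \<xi> = \<theta> (\<Phi> \<xi>) \<odot> \<xi>"
    by (simp del: Phi_Phi add: Phi_Phi[of "\<Phi> \<xi>"])
  then have "\<Phi> (\<Phi> \<xi>) = \<theta> (\<Phi> \<xi>) \<odot> \<Phi> \<xi>"
    using Phi_scale(2)[of \<xi> "\<theta> (\<Phi> \<xi>)"] by simp
  then have "0 = \<theta> (\<Phi> \<xi>) p *\<^sub>R \<Phi> \<xi> p"
    by (simp add: fun_eq_iff fscale_def)
  then show "\<Phi> \<xi> p = 0 p"
    using fun_cong[OF *, of p] by (auto simp: fscale_def)
qed

lemma theta_Phi [simp]:
  assumes "VF X"
  shows "\<theta> (\<Phi> X) = 0"
proof -
  have "\<Phi> (\<Phi> (\<Phi> X)) = - \<Phi> X"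
    using assms by (simp add: fscale_algebra)
  moreover have "\<Phi> (\<Phi> (\<Phi> X)) = - \<Phi> X + \<theta> (\<Phi> X) \<odot> \<xi>"
    using assms by (intro Phi_Phi) simp
  ultimately have "\<theta> (\<Phi> X) \<odot> \<xi> = 0"
    by simp
  then have "\<theta> (\<theta> (\<Phi> X) \<odot> \<xi>) = \<theta> (0 \<odot> \<xi>)"
    by (simp add: fscale_algebra)
  then show ?thesis
    by (simp del: fscale_algebra)
qed

lemma metric_xi [simp]:
  assumes "VF X"
  shows "\<langle>X, \<xi>\<rangle> = \<theta> X" "\<langle>\<xi>, X\<rangle> = \<theta> X"
proof -
  have "\<langle>\<Phi> X, 0 \<odot> \<xi>\<rangle> = \<langle>X, \<xi>\<rangle> - \<theta> X"
    using metric_Phi_Phi[of X \<xi>] assms by (simp add: fscale_algebra)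
  then show "\<langle>X, \<xi>\<rangle> = \<theta> X"
    using assms by simp
  then show "\<langle>\<xi>, X\<rangle> = \<theta> X"
    using assms by (simp add: metric_sym)
qed

lemma metric_Phi_left [simp]:
  assumes "VF X" "VF Y"
  shows "\<langle>\<Phi> X, Y\<rangle> = - \<langle>X, \<Phi> Y\<rangle>"
  using metric_Phi_Phi[of "\<Phi> X" Y] assms by simp

subsection \<open>The connection\<close>

lemma VF_D [simp]: "VF X \<Longrightarrow> VF Y \<Longrightarrow> VF (D X Y)"
  using connection by (simp add: affine_connection_def)

lemma D_add [simp]:
  assumes "VF X" "VF Y" "VF Z"
  shows "D (X + Y) Z = D X Z + D Y Z" "D Z (X + Y) = D Z X + D Z Y"
  using connection assms unfolding affine_connection_def by (simp_all add: plus_fun_def)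

lemma D_fscale [simp]:
  assumes "SF u" "VF X" "VF Y"
  shows "D (u \<odot> X) Y = u \<odot> D X Y" "D X (u \<odot> Y) = u \<odot> D X Y + deriv_along X u \<odot> Y"
proof -
  have *: "u \<odot> X = (\<lambda>p f. u p * X p f)" "u \<odot> Y = (\<lambda>p f. u p * Y p f)"
    by (auto simp: fscale_def fun_eq_iff)
  show "D (u \<odot> X) Y = u \<odot> D X Y"  "D X (u \<odot> Y) = u \<odot> D X Y + deriv_along X u \<odot> Y"
    using connection assms unfolding affine_connection_def *
    by (simp_all add: fun_eq_iff fscale_def deriv_along_def)
qed

lemma D_scaleR [simp]:
  assumes "VF X" "VF Y"
  shows "D (c *\<^sub>R X) Y = c *\<^sub>R D X Y" "D X (c *\<^sub>R Y) = c *\<^sub>R D X Y"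
proof -
  have *: "(\<lambda>p. c) \<odot> Z = c *\<^sub>R Z" for Z :: "'a vfield"
    by (simp add: fscale_def fun_eq_iff)
  show "D (c *\<^sub>R X) Y = c *\<^sub>R D X Y" "D X (c *\<^sub>R Y) = c *\<^sub>R D X Y"
    using D_fscale[of "\<lambda>p. c" X Y] assms by (simp_all add: * fscale_algebra)
qed

lemma D_minus [simp]:
  assumes "VF X" "VF Y"
  shows "D (- X) Y = - D X Y" "D X (- Y) = - D X Y"
  using D_scaleR[of X Y "-1"] assms by simp_all

lemma D_diff [simp]:
  assumes "VF X" "VF Y" "VF Z"
  shows "D (X - Y) Z = D X Z - D Y Z" "D Z (X - Y) = D Z X - D Z Y"
  using D_add[of X "- Y" Z] assms by simp_all

lemma D_zero [simp]: "VF X \<Longrightarrow> D X 0 = 0"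
  using D_scaleR[of X 0 0] by simp

lemma torsion_free:
  "VF X \<Longrightarrow> VF Y \<Longrightarrow> lie_bracket X Y = D X Y - D Y X"
  using levi_civita unfolding levi_civita_def by (simp add: fun_eq_iff)

lemma VF_lie_bracket [simp]: "VF X \<Longrightarrow> VF Y \<Longrightarrow> VF (lie_bracket X Y)"
  by (simp add: torsion_free)

lemma metric_compatible:
  "VF X \<Longrightarrow> VF Y \<Longrightarrow> VF Z \<Longrightarrow> deriv_along X \<langle>Y, Z\<rangle> = \<langle>D X Y, Z\<rangle> + \<langle>Y, D X Z\<rangle>"
  using levi_civita unfolding levi_civita_def by (simp add: fun_eq_iff deriv_along_def)

lemma deriv_theta:
  assumes "VF X" "VF Y"
  shows "deriv_along X (\<theta> Y) = \<theta> (D X Y) + \<langle>Y, D X \<xi>\<rangle>"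
  using metric_compatible[of X Y \<xi>] assms by simp

lemma theta_D_xi [simp]:
  assumes "VF X"
  shows "\<theta> (D X \<xi>) = 0"
proof
  fix p show "\<theta> (D X \<xi>) p = 0 p"
    using fun_cong[OF deriv_theta[of X \<xi>], of p] assms by simp
qed

lemma metric_Phi_eq_D_xi:
  assumes "VF X" "VF Y"
  shows "2 *\<^sub>R \<langle>X, \<Phi> Y\<rangle> = \<langle>Y, D X \<xi>\<rangle> - \<langle>X, D Y \<xi>\<rangle>"
  using ext_deriv_eta_expand[OF assms] assms by (simp add: deriv_theta torsion_free)

lemma D_xi_xi [simp]: "D \<xi> \<xi> = 0"
proof (rule field_eqI)
  fix W assume "VF W"
  then show "\<langle>D \<xi> \<xi>, W\<rangle> = \<langle>0, W\<rangle>"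
    using metric_Phi_eq_D_xi[of W \<xi>] metric_left_scale(1)[of \<xi> W 0] by (simp add: metric_sym)
qed auto

subsection \<open>The symmetric part of the covariant derivative of the Reeb field\<close>

text \<open>
  The operator \<open>S\<close> will turn out to be \<open>- \<phi>h\<close>; in this form its symmetry is visible.
\<close>

definition S :: "'a vfield \<Rightarrow> 'a vfield" where
  "S X = D X \<xi> + \<Phi> X"

lemma D_xi_eq: "D X \<xi> = S X - \<Phi> X"
  by (simp add: S_def)

lemma VF_S [simp]: "VF X \<Longrightarrow> VF (S X)"
  by (simp add: S_def)

lemma S_simps [simp]:
  assumes "VF X"
  shows "VF Y \<Longrightarrow> S (X + Y) = S X + S Y" "VF Y \<Longrightarrow> S (X - Y) = S X - S Y" "S (- X) = - S X"
    "S (c *\<^sub>R X) = c *\<^sub>R S X"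
  using assms by (simp_all add: S_def algebra_simps)

lemma S_fscale [simp]: "SF u \<Longrightarrow> VF X \<Longrightarrow> S (u \<odot> X) = u \<odot> S X"
  by (simp add: S_def fscale_algebra)

lemma S_xi [simp]: "S \<xi> = 0"
  by (simp add: S_def)

lemma theta_S [simp]: "VF X \<Longrightarrow> \<theta> (S X) = 0"
  by (simp add: S_def)

text \<open>
  By the contact condition \<open>d\<eta>(X,Y) = g(X,\<phi>Y)\<close> the skew part of \<open>X \<mapsto> D\<^sub>X \<xi>\<close> is \<open>- \<phi>\<close>, and it cancels in \<open>S\<close>.
\<close>

lemma S_symmetric:
  assumes "VF X" "VF Y"
  shows "\<langle>S X, Y\<rangle> = \<langle>X, S Y\<rangle>"
proof
  fix p show "\<langle>S X, Y\<rangle> p = \<langle>X, S Y\<rangle> p"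
    using fun_cong[OF metric_Phi_eq_D_xi[OF assms], of p] assms
    by (simp add: S_def metric_sym[of Y "D X \<xi>"])
qed

lemma metric_Phi_swap: "VF X \<Longrightarrow> VF Y \<Longrightarrow> \<langle>X, \<Phi> Y\<rangle> = - \<langle>Y, \<Phi> X\<rangle>"
  using metric_Phi_left[of Y X] by (simp add: metric_sym)

subsection \<open>Covariant derivative of the endomorphism field\<close>

text \<open>The covariant derivative \<open>(D\<^sub>X \<phi>) Y\<close>.\<close>

definition DPhi :: "'a vfield \<Rightarrow> 'a vfield \<Rightarrow> 'a vfield" where
  "DPhi X Y = D X (\<Phi> Y) - \<Phi> (D X Y)"

lemma VF_DPhi [simp]: "VF X \<Longrightarrow> VF Y \<Longrightarrow> VF (DPhi X Y)"
  by (simp add: DPhi_def)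

lemma D_Phi_eq: "D X (\<Phi> Y) = DPhi X Y + \<Phi> (D X Y)"
  by (simp add: DPhi_def)

lemma DPhi_skew:
  assumes "VF X" "VF Y" "VF Z"
  shows "\<langle>DPhi X Y, Z\<rangle> = - \<langle>DPhi X Z, Y\<rangle>"
proof
  fix p
  have "deriv_along X \<langle>\<Phi> Y, Z\<rangle> p = - deriv_along X \<langle>Y, \<Phi> Z\<rangle> p"
    using assms by simp
  moreover have "deriv_along X \<langle>\<Phi> Y, Z\<rangle> p = \<langle>D X (\<Phi> Y), Z\<rangle> p - \<langle>Y, \<Phi> (D X Z)\<rangle> p"
    using assms metric_compatible[of X "\<Phi> Y" Z] by simp
  moreover have "deriv_along X \<langle>Y, \<Phi> Z\<rangle> p = \<langle>D X Y, \<Phi> Z\<rangle> p + \<langle>Y, D X (\<Phi> Z)\<rangle> p"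
    using assms metric_compatible[of X Y "\<Phi> Z"] by simp
  moreover have "\<langle>Y, \<Phi> (D X Z)\<rangle> p = - \<langle>D X Z, \<Phi> Y\<rangle> p"
    using assms metric_Phi_swap[of Y "D X Z"] by simp
  moreover have "\<langle>Y, D X (\<Phi> Z)\<rangle> p = \<langle>D X (\<Phi> Z), Y\<rangle> p"
    using assms metric_sym[of Y "D X (\<Phi> Z)"] by simp
  ultimately show "\<langle>DPhi X Y, Z\<rangle> p = (- \<langle>DPhi X Z, Y\<rangle>) p"
    using assms by (simp add: DPhi_def)
qed

text \<open>
  Brackets of smooth fields vanish on functions that are not smooth, so only smooth functions need
  the linearity of the fields.
\<close>

lemma jacobi:
  assumes "VF X" "VF Y" "VF Z"
  shows "lie_bracket (lie_bracket X Y) Z + lie_bracket (lie_bracket Y Z) X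
    + lie_bracket (lie_bracket Z X) Y = 0"
proof -
  have eq: "V = W" if "\<And>u. deriv_along V u = deriv_along W u" for V W :: "'a vfield"
    using that by (simp add: deriv_along_def fun_eq_iff)
  have ns: "deriv_along V u = 0" if "VF V" "\<not> SF u" for V u
    using that unfolding VF_iff tangent_space_iff by (simp add: deriv_along_def fun_eq_iff)
  show ?thesis
  proof (rule eq)
    fix u
    show "deriv_along (lie_bracket (lie_bracket X Y) Z + lie_bracket (lie_bracket Y Z) X
      + lie_bracket (lie_bracket Z X) Y) u = deriv_along 0 u"
      using assms by (cases "SF u") (simp_all add: ns)
  qed
qed

text \<open>
  The closedness \<open>d(d\<eta>) = 0\<close>, written with the connection. Cartan's formula for \<open>d(d\<eta>)\<close> reduces to
  the Jacobi identity when \<open>d\<eta>\<close> is expanded through \<open>\<eta>\<close>; when it is expanded through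
  \<open>d\<eta>(Y,Z) = g(Y,\<phi>Z)\<close> and the torsion-free connection, only the derivatives of \<open>\<phi>\<close> remain.
\<close>

lemma DPhi_cyclic:
  assumes [simp]: "VF X" "VF Y" "VF Z"
  shows "\<langle>DPhi X Y, Z\<rangle> + \<langle>DPhi Y Z, X\<rangle> + \<langle>DPhi Z X, Y\<rangle> = 0"
proof
  fix p
  \<comment> \<open>The first two facts expand \<open>d\<eta>\<close> through \<open>\<eta>\<close>, the next two through \<open>\<phi>\<close> and the connection.\<close>
  have outer: "2 *\<^sub>R deriv_along U \<langle>V, \<Phi> W\<rangle> = deriv_along U (deriv_along V (\<theta> W))
      - deriv_along U (deriv_along W (\<theta> V)) - deriv_along U (\<theta> (lie_bracket V W))"
    if "VF U" "VF V" "VF W" for U V W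
    using arg_cong[OF ext_deriv_eta_expand[of V W], of "deriv_along U"] that by simp
  have inner: "2 *\<^sub>R \<langle>lie_bracket U V, \<Phi> W\<rangle> = deriv_along U (deriv_along V (\<theta> W))
      - deriv_along V (deriv_along U (\<theta> W)) - deriv_along W (\<theta> (lie_bracket U V))
      - \<theta> (lie_bracket (lie_bracket U V) W)"
    if "VF U" "VF V" "VF W" for U V W
    using ext_deriv_eta_expand[of "lie_bracket U V" W] that by simp
  have product: "deriv_along U \<langle>V, \<Phi> W\<rangle>
      = \<langle>D U V, \<Phi> W\<rangle> - \<langle>D U W, \<Phi> V\<rangle> - \<langle>DPhi U V, W\<rangle>"
    if "VF U" "VF V" "VF W" for U V W
    using that DPhi_skew[of U V W] metric_compatible[of U V "\<Phi> W"]
      metric_sym[of V "DPhi U W"] metric_Phi_swap[of V "D U W"]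
    by (simp add: D_Phi_eq)
  have bracket: "\<langle>lie_bracket U V, \<Phi> W\<rangle> = \<langle>D U V, \<Phi> W\<rangle> - \<langle>D V U, \<Phi> W\<rangle>"
    if "VF U" "VF V" "VF W" for U V W
    using that by (simp add: torsion_free)
  have jac: "\<theta> (lie_bracket (lie_bracket X Y) Z) + \<theta> (lie_bracket (lie_bracket Y Z) X)
      + \<theta> (lie_bracket (lie_bracket Z X) Y) = 0"
    using arg_cong[OF jacobi[of X Y Z], of \<theta>] theta_scale(1)[of \<xi> 0] by simp
  have "deriv_along X \<langle>Y, \<Phi> Z\<rangle> p + deriv_along Y \<langle>Z, \<Phi> X\<rangle> p + deriv_along Z \<langle>X, \<Phi> Y\<rangle> p
    = \<langle>lie_bracket X Y, \<Phi> Z\<rangle> p + \<langle>lie_bracket Y Z, \<Phi> X\<rangle> p + \<langle>lie_bracket Z X, \<Phi> Y\<rangle> p"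
    using fun_cong[OF outer[of X Y Z], of p] fun_cong[OF outer[of Y Z X], of p]
      fun_cong[OF outer[of Z X Y], of p] fun_cong[OF inner[of X Y Z], of p]
      fun_cong[OF inner[of Y Z X], of p] fun_cong[OF inner[of Z X Y], of p]
      fun_cong[OF jac, of p]
    by simp
  then show "(\<langle>DPhi X Y, Z\<rangle> + \<langle>DPhi Y Z, X\<rangle> + \<langle>DPhi Z X, Y\<rangle>) p = 0 p"
    by (simp add: product bracket)
qed

text \<open>
  In the cyclic identity for \<open>\<xi>, Y, Z\<close> the other two terms involve \<open>\<phi>\<close> differentiated at \<open>\<xi>\<close>, which
  is \<open>(D\<^sub>V \<phi>) \<xi> = - \<phi> (D\<^sub>V \<xi>)\<close> because \<open>\<phi>\<xi> = 0\<close>.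
\<close>

lemma DPhi_xi_eq:
  assumes "VF Y"
  shows "DPhi \<xi> Y = - (S (\<Phi> Y) + \<Phi> (S Y))"
proof (rule field_eqI)
  fix Z assume Z: "VF Z"
  have T: "\<langle>DPhi V \<xi>, W\<rangle> = - \<langle>\<Phi> (S V), W\<rangle> - \<langle>V, W\<rangle> + \<theta> V * \<theta> W" if "VF V" "VF W" for V W
    using that by (simp add: DPhi_def D_xi_eq)
  have "\<langle>S Z, \<Phi> Y\<rangle> = \<langle>S (\<Phi> Y), Z\<rangle>"
    using assms Z S_symmetric[of Z "\<Phi> Y"] metric_sym[of Z "S (\<Phi> Y)"] by simp
  then have "\<langle>DPhi \<xi> Y, Z\<rangle> p = \<langle>- (S (\<Phi> Y) + \<Phi> (S Y)), Z\<rangle> p" for p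
    using fun_cong[OF DPhi_cyclic[of \<xi> Y Z], of p] fun_cong[OF DPhi_skew[of Y Z \<xi>], of p]
      fun_cong[OF T[of Y Z], of p] fun_cong[OF T[of Z Y], of p] metric_sym[of Y Z] assms Z
    by (simp add: mult.commute)
  then show "\<langle>DPhi \<xi> Y, Z\<rangle> = \<langle>- (S (\<Phi> Y) + \<Phi> (S Y)), Z\<rangle>"
    by blast
qed (use assms in auto)

text \<open>
  Differentiating \<open>\<phi>\<^sup>2 = - id + \<eta> \<otimes> \<xi>\<close> along \<open>\<xi>\<close> shows that \<open>D\<^sub>\<xi> \<phi>\<close> anticommutes with \<open>\<phi>\<close>. For
  \<open>P = S\<phi> + \<phi>S\<close> the relation \<open>P\<phi> + \<phi>P = 0\<close> reads \<open>\<phi>S\<phi> = S\<close>, and applying \<open>\<phi>\<close> once more yields \<open>P = 0\<close>.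
\<close>

lemma S_Phi [simp]:
  assumes "VF Y"
  shows "S (\<Phi> Y) = - \<Phi> (S Y)"
proof -
  have "DPhi \<xi> (\<Phi> Y) + \<Phi> (DPhi \<xi> Y) = 0"
    using assms by (simp add: DPhi_def deriv_theta fscale_algebra)
  then have "\<Phi> (S (\<Phi> Y)) + \<Phi> (S (\<Phi> Y)) = S Y + S Y"
    using assms by (simp add: DPhi_xi_eq fscale_algebra algebra_simps)
  then have "\<Phi> (S (\<Phi> Y)) = S Y"
    by (simp add: fun_eq_iff)
  then have "\<Phi> (\<Phi> (S (\<Phi> Y))) = \<Phi> (S Y)"
    by simp
  moreover have "\<Phi> (\<Phi> (S (\<Phi> Y))) = - S (\<Phi> Y)"
    using assms by (simp add: fscale_algebra)
  ultimately show ?thesis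
    by (simp add: minus_equation_iff)
qed

lemma D_xi_Phi [simp]: "VF Y \<Longrightarrow> D \<xi> (\<Phi> Y) = \<Phi> (D \<xi> Y)"
  using DPhi_xi_eq[of Y] by (simp add: DPhi_def)

lemma lie_bracket_xi: "VF X \<Longrightarrow> lie_bracket X \<xi> = S X - \<Phi> X - D \<xi> X"
  by (simp add: torsion_free D_xi_eq)

lemma h_op_eq:
  assumes "VF X"
  shows "h_op \<phi> \<xi> X = \<Phi> (S X)"
proof -
  have "lie_deriv_endo \<xi> \<Phi> X = lie_bracket \<xi> (\<Phi> X) - \<Phi> (lie_bracket \<xi> X)"
    by (simp add: lie_deriv_endo_def fun_eq_iff)
  also have "\<dots> = \<Phi> (S X) + \<Phi> (S X)"
    using assms by (simp add: torsion_free D_xi_eq algebra_simps)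
  finally show ?thesis
    by (simp add: h_op_def fun_eq_iff)
qed

lemma phi_h_eq:
  assumes "VF X"
  shows "\<Phi> (h_op \<phi> \<xi> X) = - S X"
  using assms by (simp add: h_op_eq fscale_algebra)

text \<open>
  A symmetric operator is tensorial: if \<open>U = X - Y\<close> vanishes at \<open>p\<close>, then
  \<open>g(S U, S U) = g(U, S (S U))\<close> vanishes at \<open>p\<close>.
\<close>

lemma S_tensorial:
  assumes "VF X" "VF Y" "X p = Y p"
  shows "S X p = S Y p"
proof -
  have "\<langle>S (X - Y), S (X - Y)\<rangle> = \<langle>X - Y, S (S (X - Y))\<rangle>"
    using assms by (intro S_symmetric) simp_all
  moreover have "\<langle>X - Y, S (S (X - Y))\<rangle> p = 0"
    using assms g_scale(1)[of "X p" p "S (S (X - Y)) p" 0] by (simp add: app_def)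
  ultimately have "g p (S (X - Y) p) (S (X - Y) p) = 0"
    by (simp add: app_def fun_eq_iff)
  moreover have "S (X - Y) p \<in> tangent_space A p"
    using assms(1,2) by (intro VF_in_tangent_space VF_S VF_diff)
  ultimately have "S (X - Y) p = 0"
    using g_pos by fastforce
  then show ?thesis
    using assms(1,2) by simp
qed

subsection \<open>Sufficient conditions for the Sasakian property\<close>

lemma Sasakian_of_vanishing_Phi:
  assumes "\<And>X. VF X \<Longrightarrow> \<Phi> X = 0"
  shows "sasakian A \<phi> \<xi> \<eta> g"
proof -
  have "lie_bracket 0 0 = (0 :: 'a vfield)"
    by (simp add: torsion_free)
  then show ?thesis
    using contact assms by (simp add: sasakian_def nijenhuis_def ext_deriv_eta)
qed

lemma nijenhuis_eq_DPhi:
  assumes "VF X" "VF Y"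
  shows "nijenhuis \<phi> X Y
    = DPhi (\<Phi> X) Y - DPhi (\<Phi> Y) X + \<Phi> (DPhi Y X) - \<Phi> (DPhi X Y)"
proof -
  have "nijenhuis \<phi> X Y = \<Phi> (\<Phi> (lie_bracket X Y)) + lie_bracket (\<Phi> X) (\<Phi> Y)
      - \<Phi> (lie_bracket (\<Phi> X) Y) - \<Phi> (lie_bracket X (\<Phi> Y))"
    by (simp add: nijenhuis_def fun_eq_iff)
  also have "\<dots> = DPhi (\<Phi> X) Y - DPhi (\<Phi> Y) X + \<Phi> (DPhi Y X) - \<Phi> (DPhi X Y)"
    using assms by (simp add: torsion_free D_Phi_eq algebra_simps)
  finally show ?thesis .
qed

text \<open>One half of the classical characterisation of Sasakian manifolds by their \<open>D \<phi>\<close>.\<close>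

lemma Sasakian_of_DPhi:
  assumes DPhi: "\<And>X Y. VF X \<Longrightarrow> VF Y \<Longrightarrow> DPhi X Y = \<langle>X, Y\<rangle> \<odot> \<xi> - \<theta> Y \<odot> X"
  shows "sasakian A \<phi> \<xi> \<eta> g"
proof -
  have "nijenhuis \<phi> X Y = - (2 *\<^sub>R \<langle>X, \<Phi> Y\<rangle> \<odot> \<xi>)" if "VF X" "VF Y" for X Y
  proof -
    have "nijenhuis \<phi> X Y = - (\<langle>X, \<Phi> Y\<rangle> \<odot> \<xi>) - \<langle>X, \<Phi> Y\<rangle> \<odot> \<xi>"
      using that metric_Phi_swap[of Y X]
      by (simp add: nijenhuis_eq_DPhi DPhi fscale_algebra)
    then show ?thesis
      by (simp add: fun_eq_iff fscale_def)
  qed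
  then show ?thesis
    using contact by (simp add: sasakian_def ext_deriv_eta fscale_def)
qed

end

section \<open>Contact metric \<open>(\<kappa>, \<mu>)\<close>-spaces\<close>

locale kappa_mu_space = contact_metric_levi_civita A \<phi> \<xi> \<eta> g D
  for A :: "('a::{t2_space,second_countable_topology}, 'e::euclidean_space) chart set"
    and \<phi> \<xi> \<eta> g D +
  fixes \<kappa> \<mu> :: real
  assumes curvature_xi: "\<And>X Y. VF X \<Longrightarrow> VF Y \<Longrightarrow>
    curvature D X Y \<xi> = \<kappa> *\<^sub>R (\<theta> Y \<odot> X - \<theta> X \<odot> Y)
      + \<mu> *\<^sub>R (\<theta> Y \<odot> h_op \<phi> \<xi> X - \<theta> X \<odot> h_op \<phi> \<xi> Y)"
begin

subsection \<open>The square and the covariant derivative of \<open>S\<close>\<close>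

lemma curvature_eq:
  "curvature D X Y Z = D X (D Y Z) - D Y (D X Z) - D (lie_bracket X Y) Z"
  by (simp add: curvature_def fun_eq_iff)

text \<open>The covariant derivative \<open>(D\<^sub>\<xi> S) X\<close>.\<close>

definition Dxi_S :: "'a vfield \<Rightarrow> 'a vfield" where
  "Dxi_S X = D \<xi> (S X) - S (D \<xi> X)"

lemma VF_Dxi_S [simp]: "VF X \<Longrightarrow> VF (Dxi_S X)"
  by (simp add: Dxi_S_def)

text \<open>
  The curvature condition for \<open>R(X,\<xi>)\<xi>\<close>, with the left-hand side computed from
  \<open>D\<^sub>X \<xi> = S X - \<phi> X\<close>.
\<close>

lemma jacobi_operator:
  assumes "VF X"
  shows "- Dxi_S X - S (S X) + X - \<theta> X \<odot> \<xi> = \<kappa> *\<^sub>R (X - \<theta> X \<odot> \<xi>) + \<mu> *\<^sub>R \<Phi> (S X)"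
proof -
  have "curvature D X \<xi> \<xi> = - Dxi_S X - S (S X) + X - \<theta> X \<odot> \<xi>"
    using assms
    by (simp add: curvature_eq D_xi_eq lie_bracket_xi Dxi_S_def fscale_algebra algebra_simps)
  moreover have "h_op \<phi> \<xi> \<xi> = 0"
    by (simp add: h_op_eq)
  ultimately show ?thesis
    using curvature_xi[of X \<xi>] assms by (simp add: h_op_eq fscale_algebra)
qed

lemma Dxi_S_Phi: "VF X \<Longrightarrow> Dxi_S (\<Phi> X) = - \<Phi> (Dxi_S X)"
  by (simp add: Dxi_S_def)

text \<open>
  In the preceding identity \<open>S\<^sup>2\<close> commutes with \<open>\<phi>\<close>, whereas \<open>D\<^sub>\<xi> S\<close> and \<open>\<phi>S\<close> anticommute with it. The
  identity for \<open>\<phi>X\<close> and the image of the identity under \<open>\<phi>\<close> therefore differ in the sign of the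
  anticommuting terms, and their sum and difference isolate the two parts.
\<close>

lemma S_squared_and_Dxi_S:
  assumes "VF X"
  shows "S (S X) = (1 - \<kappa>) *\<^sub>R (X - \<theta> X \<odot> \<xi>)" "Dxi_S X = - \<mu> *\<^sub>R \<Phi> (S X)"
proof -
  have 1: "\<Phi> (Dxi_S X) - \<Phi> (S (S X)) + \<Phi> X = \<kappa> *\<^sub>R \<Phi> X + \<mu> *\<^sub>R S X"
    using jacobi_operator[of "\<Phi> X"] assms by (simp add: Dxi_S_Phi fscale_algebra)
  have 2: "- \<Phi> (Dxi_S X) - \<Phi> (S (S X)) + \<Phi> X = \<kappa> *\<^sub>R \<Phi> X - \<mu> *\<^sub>R S X"
    using arg_cong[OF jacobi_operator[of X], of \<Phi>] assms by (simp add: fscale_algebra)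
  have 3: "\<theta> (Dxi_S X) = 0"
    using arg_cong[OF jacobi_operator[of X], of \<theta>] assms by simp
  have 4: "\<Phi> (Dxi_S X) = \<mu> *\<^sub>R S X"
  proof (intro ext)
    fix p f show "\<Phi> (Dxi_S X) p f = (\<mu> *\<^sub>R S X) p f"
      using fun_cong[OF fun_cong[OF 1, of p], of f] fun_cong[OF fun_cong[OF 2, of p], of f] by simp
  qed
  have 5: "\<Phi> (S (S X)) = (1 - \<kappa>) *\<^sub>R \<Phi> X"
    using 1 by (simp add: 4 algebra_simps)
  have "- Dxi_S X = - (- \<mu> *\<^sub>R \<Phi> (S X))"
    using arg_cong[OF 4, of \<Phi>] assms by (simp add: 3 fscale_algebra)
  then show "Dxi_S X = - \<mu> *\<^sub>R \<Phi> (S X)"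
    by (metis neg_equal_iff_equal)
  have "- S (S X) = - ((1 - \<kappa>) *\<^sub>R (X - \<theta> X \<odot> \<xi>))"
    using arg_cong[OF 5, of \<Phi>] assms by (simp add: fscale_algebra scaleR_diff_right)
  then show "S (S X) = (1 - \<kappa>) *\<^sub>R (X - \<theta> X \<odot> \<xi>)"
    by (metis neg_equal_iff_equal)
qed

text \<open>
  With \<open>D\<^sub>X \<xi> = - \<phi> X\<close> the curvature \<open>R(X,Y)\<xi>\<close> is \<open>(D\<^sub>Y \<phi>) X - (D\<^sub>X \<phi>) Y\<close>. By the cyclic identity this
  difference, paired with \<open>Z\<close>, is \<open>g((D\<^sub>Z \<phi>) X, Y)\<close>, so the curvature condition determines \<open>D \<phi>\<close>.
\<close>

lemma Sasakian_of_vanishing_S: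
  assumes "\<kappa> = 1" and S0: "\<And>X. VF X \<Longrightarrow> S X = 0"
  shows "sasakian A \<phi> \<xi> \<eta> g"
proof (rule Sasakian_of_DPhi)
  have alt: "DPhi Y X - DPhi X Y = \<theta> Y \<odot> X - \<theta> X \<odot> Y" if "VF X" "VF Y" for X Y
    using curvature_xi[of X Y] that assms(1)
    by (simp add: curvature_eq h_op_eq S0 D_xi_eq fscale_algebra torsion_free D_Phi_eq)
  fix Z X assume [simp]: "VF Z" "VF X"
  show "DPhi Z X = \<langle>Z, X\<rangle> \<odot> \<xi> - \<theta> X \<odot> Z"
  proof (rule field_eqI)
    fix Y assume [simp]: "VF Y"
    have "\<langle>DPhi Y X, Z\<rangle> - \<langle>DPhi X Y, Z\<rangle> = \<theta> Y * \<langle>X, Z\<rangle> - \<theta> X * \<langle>Y, Z\<rangle>"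
      using arg_cong[OF alt[of X Y], of "\<lambda>V. \<langle>V, Z\<rangle>"] by simp
    then have "\<langle>DPhi Z X, Y\<rangle> = \<theta> Y * \<langle>X, Z\<rangle> - \<theta> X * \<langle>Y, Z\<rangle>"
      using DPhi_cyclic[of X Y Z] DPhi_skew[of Y Z X] by (simp add: fun_eq_iff algebra_simps) (smt (verit))
    then show "\<langle>DPhi Z X, Y\<rangle> = \<langle>\<langle>Z, X\<rangle> \<odot> \<xi> - \<theta> X \<odot> Z, Y\<rangle>"
      using metric_sym[of X Z] metric_sym[of Y Z] by (simp add: mult.commute)
  qed auto
qed

subsection \<open>Pang's form on the eigendistributions\<close>

lemma theta_eigen:
  assumes "VF X" "S X = s *\<^sub>R X" "s \<noteq> 0"
  shows "\<theta> X = 0"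
  using theta_S[of X] assms by (simp add: fun_eq_iff)

text \<open>
  Writing \<open>W = [X,\<xi>]\<close>, the definition of Pang's form unfolds to \<open>- \<eta>([Y,W])\<close>, which is
  \<open>2 d\<eta>(Y,W) = 2 g(Y,\<phi>W)\<close> since \<open>\<eta>\<close> vanishes on \<open>Y\<close> and \<open>W\<close>. Both facts about \<open>s\<close> used after that come
  from moving \<open>S\<close> across the metric: \<open>\<phi>X\<close> is an eigenfield for \<open>- s\<close>, hence orthogonal to \<open>Y\<close>; and
  pairing \<open>\<phi>S D\<^sub>\<xi> X\<close> with \<open>Y\<close> gives \<open>- s g(Y, \<phi> D\<^sub>\<xi> X)\<close>, whereas \<open>S D\<^sub>\<xi> X = s D\<^sub>\<xi> X + \<mu> s \<phi>X\<close> by the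
  formula for \<open>D\<^sub>\<xi> S\<close>.
\<close>

lemma pang_eigenfields:
  assumes X [simp]: "VF X" and Y [simp]: "VF Y"
    and SX: "S X = s *\<^sub>R X" and SY: "S Y = s *\<^sub>R Y" and "s \<noteq> 0"
  shows "pang \<xi> \<eta> X Y = (2 - \<mu>) *\<^sub>R \<langle>X, Y\<rangle>"
proof
  fix p
  define W where "W = lie_bracket X \<xi>"
  have W [simp]: "VF W" and W_eq: "W = s *\<^sub>R X - \<Phi> X - D \<xi> X"
    by (simp_all add: W_def lie_bracket_xi SX)
  have \<theta>X: "\<theta> X = 0" and \<theta>Y: "\<theta> Y = 0"
    using theta_eigen[OF _ SX] theta_eigen[OF _ SY] assms(5) by simp_all
  have \<theta>DX: "\<theta> (D \<xi> X) = 0" and \<theta>DY: "\<theta> (D \<xi> Y) = 0"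
    using deriv_theta[of \<xi> X] deriv_theta[of \<xi> Y] by (simp_all add: \<theta>X \<theta>Y)
  have \<theta>W: "\<theta> W = 0"
    by (simp add: W_eq \<theta>X \<theta>DX)
  have "\<theta> (lie_bracket Y \<xi>) = 0"
    by (simp add: lie_bracket_xi \<theta>DY)
  then have "pang \<xi> \<eta> X Y = - \<theta> (lie_bracket Y W)"
  proof -
    have L: "lie_deriv_form Y \<theta> V = deriv_along Y (\<theta> V) - \<theta> (lie_bracket Y V)" for V
      by (simp add: lie_deriv_form_def deriv_along_def fun_eq_iff)
    have "pang \<xi> \<eta> X Y = lie_deriv_form Y \<theta> W - deriv_along X (lie_deriv_form Y \<theta> \<xi>)"
      by (simp add: pang_def lie_deriv_form_def[of X] W_def deriv_along_def fun_eq_iff)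
    with \<open>\<theta> (lie_bracket Y \<xi>) = 0\<close> show ?thesis
      by (simp add: L \<theta>W)
  qed
  also have "\<dots> = 2 *\<^sub>R \<langle>Y, \<Phi> W\<rangle>"
    using ext_deriv_eta_expand[of Y W] by (simp add: \<theta>W \<theta>Y)
  finally have pang: "pang \<xi> \<eta> X Y p = 2 * \<langle>Y, \<Phi> W\<rangle> p"
    by simp
  have "s * \<langle>Y, \<Phi> X\<rangle> p = - (s * \<langle>Y, \<Phi> X\<rangle> p)"
    using fun_cong[OF S_symmetric[of Y "\<Phi> X"], of p] by (simp add: SX SY)
  then have orth: "\<langle>Y, \<Phi> X\<rangle> p = 0"
    using assms(5) by simp
  have "S (D \<xi> X) = s *\<^sub>R D \<xi> X + (\<mu> * s) *\<^sub>R \<Phi> X"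
    using S_squared_and_Dxi_S(2)[of X] by (simp add: Dxi_S_def SX algebra_simps)
  then have "\<langle>Y, \<Phi> (S (D \<xi> X))\<rangle> p = s * \<langle>Y, \<Phi> (D \<xi> X)\<rangle> p - \<mu> * s * \<langle>Y, X\<rangle> p"
    by (simp add: \<theta>X fscale_algebra)
  moreover have "\<langle>Y, \<Phi> (S (D \<xi> X))\<rangle> p = - (s * \<langle>Y, \<Phi> (D \<xi> X)\<rangle> p)"
    using fun_cong[OF S_symmetric[of Y "\<Phi> (D \<xi> X)"], of p] by (simp add: SY)
  ultimately have "s * (2 * \<langle>Y, \<Phi> (D \<xi> X)\<rangle> p - \<mu> * \<langle>Y, X\<rangle> p) = 0"
    by (auto simp: algebra_simps)
  then have "2 * \<langle>Y, \<Phi> (D \<xi> X)\<rangle> p = \<mu> * \<langle>Y, X\<rangle> p"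
    using assms(5) by auto
  then show "pang \<xi> \<eta> X Y p = ((2 - \<mu>) *\<^sub>R \<langle>X, Y\<rangle>) p"
    by (simp add: pang W_eq orth \<theta>X fscale_algebra metric_sym[of X Y] algebra_simps)
qed

lemma eigendistribution_iff:
  assumes "VF X"
  shows "X p \<in> eigendistribution_phi_h A \<phi> \<xi> c p \<longleftrightarrow> S X p = - c *\<^sub>R X p"
proof -
  have *: "\<Phi> (h_op \<phi> \<xi> Y) p = (\<lambda>f. c * X p f) \<longleftrightarrow> S X p = - c *\<^sub>R X p"
    if "VF Y" "Y p = X p" for Y
  proof -
    have "\<Phi> (h_op \<phi> \<xi> Y) p = - S X p"
      using phi_h_eq[of Y] S_tensorial[of Y X p] assms that by simp
    then show ?thesis
      by (auto simp: fun_eq_iff minus_equation_iff)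
  qed
  show ?thesis
    unfolding eigendistribution_phi_h_def using * assms by auto
qed

lemma eigendistributionE:
  assumes "v \<in> eigendistribution_phi_h A \<phi> \<xi> c p"
  obtains X where "VF X" "X p = v" "S X p = - c *\<^sub>R v"
  using assms eigendistribution_iff unfolding eigendistribution_phi_h_def by blast

lemma sections_eigendistribution:
  "X \<in> sections_of A (eigendistribution_phi_h A \<phi> \<xi> c) \<longleftrightarrow> VF X \<and> S X = - c *\<^sub>R X"
  using eigendistribution_iff[of X] by (auto simp: sections_of_def fun_eq_iff)

text \<open>
  Pang's form on a fibre is defined through sections, so every vector of the fibre must extend to
  one. On \<open>ker \<eta>\<close> we have \<open>S\<^sup>2 = c\<^sup>2\<close>; there \<open>(S\<^sup>2 - c S) / (2 c\<^sup>2)\<close> is the projection onto the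
  eigenspace of \<open>S\<close> for \<open>- c\<close>, and it annihilates \<open>\<xi>\<close>.
\<close>

lemma section_through:
  assumes v: "v \<in> eigendistribution_phi_h A \<phi> \<xi> c p" and c: "c \<noteq> 0" "c\<^sup>2 = 1 - \<kappa>"
  obtains X where "VF X" "S X = - c *\<^sub>R X" "X p = v"
proof -
  obtain Y where [simp]: "VF Y" and Yp: "Y p = v" and SYp: "S Y p = - c *\<^sub>R v"
    using v by (rule eigendistributionE)
  define V where "V = S (S Y) - c *\<^sub>R S Y"
  have [simp]: "VF V"
    by (simp add: V_def)
  \<comment> \<open>Eigenvectors for non-zero eigenvalues lie in \<open>ker \<eta>\<close>, which contains the image of \<open>S\<close>.\<close>
  have "\<theta> Y p = 0"
  proof -
    have "- c * \<theta> Y p = 0"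
      using fun_cong[OF theta_S[of Y], of p] eta_scale(1)[of "Y p" p "- c"]
      unfolding app_def SYp Yp[symmetric] by simp
    then show ?thesis
      using c(1) by simp
  qed
  then have SSYp: "S (S Y) p = c\<^sup>2 *\<^sub>R v"
    using S_squared_and_Dxi_S(1)[of Y] by (simp add: c(2) Yp fscale_def)
  have Vp: "V p = (2 * c\<^sup>2) *\<^sub>R v"
  proof -
    have "V p = c\<^sup>2 *\<^sub>R v + (c * c) *\<^sub>R v"
      by (simp add: V_def SYp SSYp)
    also have "\<dots> = (c\<^sup>2 + c * c) *\<^sub>R v"
      by (rule scaleR_add_left[symmetric])
    finally show ?thesis
      by (simp add: power2_eq_square)
  qed
  have "S (S (S Y)) = c\<^sup>2 *\<^sub>R S Y"
    using S_squared_and_Dxi_S(1)[of "S Y"] by (simp add: c(2) fscale_algebra)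
  then have SV: "S V = - c *\<^sub>R V"
    by (simp add: V_def scaleR_diff_right power2_eq_square)
  show thesis
  proof (rule that)
    show "VF ((1 / (2 * c\<^sup>2)) *\<^sub>R V)"
      by simp
    show "S ((1 / (2 * c\<^sup>2)) *\<^sub>R V) = - c *\<^sub>R (1 / (2 * c\<^sup>2)) *\<^sub>R V"
      by (simp add: SV)
    show "((1 / (2 * c\<^sup>2)) *\<^sub>R V) p = v"
      using c(1) by (simp add: Vp)
  qed
qed

lemma pang_at_eigendistribution:
  assumes "c \<noteq> 0" "c\<^sup>2 = 1 - \<kappa>"
    and "v \<in> eigendistribution_phi_h A \<phi> \<xi> c p" "w \<in> eigendistribution_phi_h A \<phi> \<xi> c p"
  shows "pang_at A \<xi> \<eta> (eigendistribution_phi_h A \<phi> \<xi> c) p v w = (2 - \<mu>) * g p v w"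
proof -
  let ?F = "eigendistribution_phi_h A \<phi> \<xi> c"
  have val: "pang \<xi> \<eta> X Y p = (2 - \<mu>) * g p (X p) (Y p)"
    if "X \<in> sections_of A ?F" "Y \<in> sections_of A ?F" for X Y
  proof -
    have "pang \<xi> \<eta> X Y = (2 - \<mu>) *\<^sub>R \<langle>X, Y\<rangle>"
      using that assms(1) unfolding sections_eigendistribution
      by (intro pang_eigenfields[of X Y "- c"]) auto
    then show ?thesis
      by (simp add: app_def)
  qed
  obtain X where X: "VF X" "S X = - c *\<^sub>R X" "X p = v"
    by (rule section_through[OF assms(3,1,2)])
  obtain Y where Y: "VF Y" "S Y = - c *\<^sub>R Y" "Y p = w"
    by (rule section_through[OF assms(4,1,2)])
  have "X \<in> sections_of A ?F" "Y \<in> sections_of A ?F"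
    unfolding sections_eigendistribution using X Y by blast+
  with X(3) Y(3) have ex: "\<exists>X \<in> sections_of A ?F. \<exists>Y \<in> sections_of A ?F.
      X p = v \<and> Y p = w \<and> (2 - \<mu>) * g p v w = pang \<xi> \<eta> X Y p"
    using val[of X Y] by (intro bexI[of _ X] bexI[of _ Y]) auto
  show ?thesis
    unfolding pang_at_def
  proof (rule the_equality)
    show "\<exists>X \<in> sections_of A ?F. \<exists>Y \<in> sections_of A ?F.
      X p = v \<and> Y p = w \<and> (2 - \<mu>) * g p v w = pang \<xi> \<eta> X Y p"
      by (rule ex)
    fix d assume "\<exists>X \<in> sections_of A ?F. \<exists>Y \<in> sections_of A ?F.
      X p = v \<and> Y p = w \<and> d = pang \<xi> \<eta> X Y p"
    then show "d = (2 - \<mu>) * g p v w"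
      using val by metis
  qed
qed

subsection \<open>Consequences of not being Sasakian\<close>

text \<open>
  For an eigenvector, start from \<open>Z = \<phi> Y\<close> and a point where \<open>Z\<close> does not vanish. The vector
  \<open>S Z - c Z\<close> lies in the eigendistribution; if it is zero, then \<open>Z\<close> belongs to the opposite
  eigenspace, which \<open>\<phi>\<close> carries into the required one.
\<close>

lemma non_Sasakian:
  assumes "\<not> sasakian A \<phi> \<xi> \<eta> g"
  shows kappa_less_1: "\<kappa> < 1"
    and nontrivial_eigendistribution:
      "c\<^sup>2 = 1 - \<kappa> \<Longrightarrow> \<exists>p. \<exists>v \<in> eigendistribution_phi_h A \<phi> \<xi> c p. v \<noteq> 0"
proof -
  \<comment> \<open>In dimension one \<open>\<phi>\<close> vanishes; this case is excluded here because it is Sasakian.\<close>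
  obtain Y where [simp]: "VF Y" and "\<Phi> Y \<noteq> 0"
    using Sasakian_of_vanishing_Phi assms by blast
  define Z where "Z = \<Phi> Y"
  have [simp]: "VF Z" and \<theta>Z [simp]: "\<theta> Z = 0"
    by (simp_all add: Z_def)
  obtain p where p: "Z p \<noteq> 0"
    using \<open>\<Phi> Y \<noteq> 0\<close> by (auto simp: Z_def fun_eq_iff)
  have SSZ: "S (S Z) = (1 - \<kappa>) *\<^sub>R Z"
    using S_squared_and_Dxi_S(1)[of Z] by (simp add: fscale_algebra)
  have nonneg: "\<langle>X, X\<rangle> p \<ge> 0" if "VF X" for X
    using g_pos[of "X p" p] g_scale(1)[of 0 p 0 0] that by (cases "X p = 0") (auto simp: app_def)
  have "\<langle>S Z, S Z\<rangle> p = (1 - \<kappa>) * \<langle>Z, Z\<rangle> p"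
    using S_symmetric[of Z "S Z"] by (simp add: SSZ)
  moreover have "\<langle>Z, Z\<rangle> p > 0"
    using g_pos[of "Z p" p] p by (simp add: app_def)
  ultimately have "\<kappa> \<le> 1"
    using nonneg[of "S Z"] by (simp add: zero_le_mult_iff)
  moreover have "\<kappa> \<noteq> 1"
  proof
    assume "\<kappa> = 1"
    then have "S X = 0" if "VF X" for X
      using S_symmetric[of X "S X"] S_squared_and_Dxi_S(1)[of X] that
      by (intro metric_self_eq_zero) simp_all
    then show False
      using Sasakian_of_vanishing_S[OF \<open>\<kappa> = 1\<close>] assms by blast
  qed
  ultimately show "\<kappa> < 1"
    by simp
  show "\<exists>p. \<exists>v \<in> eigendistribution_phi_h A \<phi> \<xi> c p. v \<noteq> 0" if c: "c\<^sup>2 = 1 - \<kappa>"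
  proof (cases "S Z p = c *\<^sub>R Z p")
    case True
    have "S (\<Phi> Z) p = - c *\<^sub>R \<Phi> Z p"
    proof -
      have "S (\<Phi> Z) p = - \<phi> p (S Z p)"
        by (simp, simp add: app_def)
      then show ?thesis
        using True phi_scale(1)[of "Z p" p c] by (simp add: app_def[of \<phi>])
    qed
    then have "\<Phi> Z p \<in> eigendistribution_phi_h A \<phi> \<xi> c p"
      by (simp add: eigendistribution_iff)
    moreover have "\<Phi> Z p \<noteq> 0"
    proof
      assume "\<Phi> Z p = 0"
      then have "\<Phi> (\<Phi> Z) p = 0"
        using phi_scale(1)[of 0 p 0] by (simp add: app_def del: Phi_Phi)
      then show False
        using p by (simp add: fscale_algebra)
    qed
    ultimately show ?thesis
      by blast
  next
    case False
    define W where "W = S Z - c *\<^sub>R Z"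
    have "S W = - c *\<^sub>R W"
      by (simp add: W_def SSZ c[symmetric] algebra_simps power2_eq_square)
    then have "W p \<in> eigendistribution_phi_h A \<phi> \<xi> c p"
      by (subst eigendistribution_iff) (simp_all add: W_def)
    moreover have "W p \<noteq> 0"
      using False by (simp add: W_def)
    ultimately show ?thesis
      by blast
  qed
qed

lemma type_of_eigenfoliation:
  assumes "\<not> sasakian A \<phi> \<xi> \<eta> g" "c\<^sup>2 = 1 - \<kappa>"
  defines "F \<equiv> eigendistribution_phi_h A \<phi> \<xi> c"
  shows "(nondegenerate_foliation A \<xi> \<eta> F \<or> flat_foliation A \<xi> \<eta> F) \<and>
    (positive_definite_foliation A \<xi> \<eta> F \<longleftrightarrow> I_inv \<kappa> \<mu> > 0) \<and>
    (negative_definite_foliation A \<xi> \<eta> F \<longleftrightarrow> I_inv \<kappa> \<mu> < 0) \<and>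
    (flat_foliation A \<xi> \<eta> F \<longleftrightarrow> I_inv \<kappa> \<mu> = 0)"
proof -
  have \<kappa>: "\<kappa> < 1" and "c \<noteq> 0"
    using kappa_less_1 assms by auto
  have form: "pang_at A \<xi> \<eta> F p v w = (2 - \<mu>) * g p v w" if "v \<in> F p" "w \<in> F p" for p v w
    using that pang_at_eigendistribution[OF \<open>c \<noteq> 0\<close> assms(2)] by (simp add: F_def)
  have pos: "g p v v > 0" if "v \<in> F p" "v \<noteq> 0" for p v
    using that by (auto simp: F_def elim!: eigendistributionE intro!: g_pos)
  obtain p v where v: "v \<in> F p" "v \<noteq> 0"
    using nontrivial_eigendistribution[OF assms(1,2)] by (auto simp: F_def)
  have I: "I_inv \<kappa> \<mu> > 0 \<longleftrightarrow> 2 - \<mu> > 0" "I_inv \<kappa> \<mu> < 0 \<longleftrightarrow> 2 - \<mu> < 0"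
    "I_inv \<kappa> \<mu> = 0 \<longleftrightarrow> 2 - \<mu> = 0"
    using \<kappa> by (auto simp: I_inv_def zero_less_divide_iff divide_less_0_iff)
  have zero: "(\<lambda>f. 0) = (0 :: 'a tvec)"
    by (simp add: fun_eq_iff)
  have "flat_foliation A \<xi> \<eta> F \<longleftrightarrow> 2 - \<mu> = 0"
    unfolding flat_foliation_def using form v pos[OF v] by fastforce
  moreover have "positive_definite_foliation A \<xi> \<eta> F \<longleftrightarrow> 2 - \<mu> > 0"
    unfolding positive_definite_foliation_def zero
    using form v pos by (auto simp: zero_less_mult_iff) (metis less_asym)
  moreover have "negative_definite_foliation A \<xi> \<eta> F \<longleftrightarrow> 2 - \<mu> < 0"
    unfolding negative_definite_foliation_def zero
    using form v pos by (auto simp: mult_less_0_iff) (metis less_asym)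
  moreover have "nondegenerate_foliation A \<xi> \<eta> F" if "2 - \<mu> \<noteq> 0"
    unfolding nondegenerate_foliation_def zero
    using form pos that by (metis less_irrefl mult_eq_0_iff)
  ultimately show ?thesis
    unfolding I by blast
qed

end

theorem theorem5p5:
  fixes A :: "('a::{t2_space,second_countable_topology}, 'e::euclidean_space) chart set"
    and \<phi> :: "'a \<Rightarrow> 'a tvec \<Rightarrow> 'a tvec"
    and \<xi> :: "'a vfield"
    and \<eta> :: "'a \<Rightarrow> 'a tvec \<Rightarrow> real"
    and g :: "'a \<Rightarrow> 'a tvec \<Rightarrow> 'a tvec \<Rightarrow> real"
    and \<kappa> \<mu> lam :: real
  assumes "contact_metric_kappa_mu_space A \<phi> \<xi> \<eta> g \<kappa> \<mu>"
    and "\<not> sasakian A \<phi> \<xi> \<eta> g"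
    and "lam = sqrt (1 - \<kappa>)"
  shows "\<forall>F \<in> {eigendistribution_phi_h A \<phi> \<xi> lam, eigendistribution_phi_h A \<phi> \<xi> (- lam)}.
    (nondegenerate_foliation A \<xi> \<eta> F \<or> flat_foliation A \<xi> \<eta> F) \<and>
    (positive_definite_foliation A \<xi> \<eta> F \<longleftrightarrow> I_inv \<kappa> \<mu> > 0) \<and>
    (negative_definite_foliation A \<xi> \<eta> F \<longleftrightarrow> I_inv \<kappa> \<mu> < 0) \<and>
    (flat_foliation A \<xi> \<eta> F \<longleftrightarrow> I_inv \<kappa> \<mu> = 0)"
proof -
  obtain D where contact: "contact_metric_manifold A \<phi> \<xi> \<eta> g" and D: "levi_civita A g D"
    and curv: "\<And>X Y. vector_field A X \<Longrightarrow> vector_field A Y \<Longrightarrow> curvature D X Y \<xi> =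
      (\<lambda>p f. \<kappa> * (app \<eta> Y p * X p f - app \<eta> X p * Y p f)
        + \<mu> * (app \<eta> Y p * h_op \<phi> \<xi> X p f - app \<eta> X p * h_op \<phi> \<xi> Y p f))"
    using assms(1) unfolding contact_metric_kappa_mu_space_def by blast
  interpret contact_metric_levi_civita A \<phi> \<xi> \<eta> g D
    using contact D by unfold_locales
  interpret kappa_mu_space A \<phi> \<xi> \<eta> g D \<kappa> \<mu>
    by unfold_locales (simp add: curv fun_eq_iff fscale_def)
  have "lam\<^sup>2 = 1 - \<kappa>" "(- lam)\<^sup>2 = 1 - \<kappa>"
    using kappa_less_1[OF assms(2)] assms(3) by simp_all
  then show ?thesis
    using type_of_eigenfoliation[OF assms(2)] by blast
qed

end
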